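(* Let $\hat G$ be a plane embedding of a connected 4-regular planar graph $G$, and let $c$ be a cut vertex of $G$. Let $K_1$ be one connected component of $G-c$, and let $K_2$ be the union of the remaining components of $G-c$. For $i=1,2$: - let $G_i$ be the subgraph of $G$ consisting of $K_i$, the vertex $c$, and all edges of $G$ with both ends in $V(K_i)\cup\{c\}$; - let $G'_i$ be the graph obtained from $G_i$ by adding one self-loop at $c$, so that $G'_i$ is 4-regular; - let $\hat G'_i$ be a plane embedding of $G'_i$ that extends the embedding of $G_i$ induced by $\hat G$. Let $C$, $C_1$, $C_2$ be the threaded circuit partitions of $\hat G$, $\hat G'_1$, $\hat G'_2$, respectively. Then $|C| = |C_1| + |C_2| - 1$.
   Context: Graphs may contain loops and multiple edges. A plane graph is a graph with a fixed planar embedding, encoded by the cyclic counterclockwise order of edge-ends (half-edges) at each vertex; a loop contributes two edge-ends at its vertex. In a 4-regular plane graph, the two threads with midpoint $\beta$ are defined as follows. Let $h_0,h_1,h_2,h_3$ be the edge-ends at $\beta$ in cyclic order. The threads are the pairs of non-consecutive edge-ends $\{h_0,h_2\}$ and $\{h_1,h_3\}$. Equivalently, a thread is a two-edge path $(\alpha,\beta,\gamma)$ whose two edge-ends at $\beta$ are not contiguous in the cyclic order around $\beta$. For each edge traversal $(\alpha,\beta)$ there is a unique thread $(\alpha,\beta,\gamma)$, and $(\beta,\gamma)$ is called the next edge. A circuit is a cyclic sequence of distinct edges $(e_0,\dots,e_{k-1})$ with $e_i=(u_i,u_{i+1})$, indices mod $k$. A circuit is threaded if each $(u_{j-1},u_j,u_{j+1})$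 is a thread. A threaded circuit partition of a 4-regular plane graph is a set of threaded circuits such that every edge lies in exactly one of them. Every 4-regular plane graph has a unique threaded circuit partition. *)

theory Defs
  imports Main
begin

text \<open>Plane graphs are encoded combinatorially as rotation systems on darts (edge-ends).
  A graph is given by a vertex set V, a dart set D, a fixed-point-free involution opp
  (the other end of the same edge), and vert (the vertex at which a dart sits).
  Loops and multiple edges are allowed. The embedding is given by rot, the
  counterclockwise successor of a dart among the darts at its vertex.\<close>

definition edge_of :: "('d \<Rightarrow> 'd) \<Rightarrow> 'd \<Rightarrow> 'd set" where
  "edge_of opp d = {d, opp d}"

definition dart_graph :: "'v set \<Rightarrow> 'd set \<Rightarrow> ('d \<Rightarrow> 'd) \<Rightarrow> ('d \<Rightarrow> 'v) \<Rightarrow> bool" where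
  "dart_graph V D opp vert \<longleftrightarrow> finite V \<and> finite D \<and>
     (\<forall>d\<in>D. opp d \<in> D \<and> opp (opp d) = d \<and> opp d \<noteq> d \<and> vert d \<in> V)"

definition rotation_system :: "'d set \<Rightarrow> ('d \<Rightarrow> 'v) \<Rightarrow> ('d \<Rightarrow> 'd) \<Rightarrow> bool" where
  "rotation_system D vert rot \<longleftrightarrow> bij_betw rot D D \<and> (\<forall>d\<in>D. vert (rot d) = vert d) \<and>
     (\<forall>d\<in>D. \<forall>d'\<in>D. vert d = vert d' \<longrightarrow> (\<exists>n. (rot ^^ n) d = d'))"

definition adj :: "'d set \<Rightarrow> ('d \<Rightarrow> 'd) \<Rightarrow> ('d \<Rightarrow> 'v) \<Rightarrow> ('v \<times> 'v) set" where
  "adj D opp vert = {(vert d, vert (opp d)) | d. d \<in> D}"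

definition connected_graph :: "'v set \<Rightarrow> 'd set \<Rightarrow> ('d \<Rightarrow> 'd) \<Rightarrow> ('d \<Rightarrow> 'v) \<Rightarrow> bool" where
  "connected_graph V D opp vert \<longleftrightarrow> (\<forall>u\<in>V. \<forall>w\<in>V. (u, w) \<in> (adj D opp vert)\<^sup>*)"

definition components :: "'v set \<Rightarrow> 'd set \<Rightarrow> ('d \<Rightarrow> 'd) \<Rightarrow> ('d \<Rightarrow> 'v) \<Rightarrow> 'v set set" where
  "components V D opp vert = (\<lambda>u. {w\<in>V. (u, w) \<in> (adj D opp vert)\<^sup>*}) ` V"

text \<open>Faces of the map: orbits of the face permutation rot o opp.\<close>
definition faces :: "'d set \<Rightarrow> ('d \<Rightarrow> 'd) \<Rightarrow> ('d \<Rightarrow> 'd) \<Rightarrow> 'd set set" where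
  "faces D opp rot = (\<lambda>d. {((rot \<circ> opp) ^^ n) d | n. True}) ` D"

definition isolated :: "'v set \<Rightarrow> 'd set \<Rightarrow> ('d \<Rightarrow> 'v) \<Rightarrow> 'v set" where
  "isolated V D vert = {v\<in>V. \<forall>d\<in>D. vert d \<noteq> v}"

text \<open>A plane embedding: a rotation system of genus 0, i.e. Euler's formula
  V - E + F = 2 holds in every component (an isolated vertex counts as having one face);
  since V - E + F \<le> 2 per component, this is the summed form.\<close>
definition plane_map :: "'v set \<Rightarrow> 'd set \<Rightarrow> ('d \<Rightarrow> 'd) \<Rightarrow> ('d \<Rightarrow> 'v) \<Rightarrow> ('d \<Rightarrow> 'd) \<Rightarrow> bool" where
  "plane_map V D opp vert rot \<longleftrightarrow> dart_graph V D opp vert \<and> rotation_system D vert rot \<and>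
     int (card V) - int (card (edge_of opp ` D)) + int (card (faces D opp rot) + card (isolated V D vert))
       = 2 * int (card (components V D opp vert))"

definition four_regular :: "'v set \<Rightarrow> 'd set \<Rightarrow> ('d \<Rightarrow> 'v) \<Rightarrow> bool" where
  "four_regular V D vert \<longleftrightarrow> (\<forall>v\<in>V. card {d\<in>D. vert d = v} = 4)"

text \<open>Threads: at a 4-valent vertex with edge-ends h0,h1,h2,h3 in cyclic order,
  the threads are {h0,h2} and {h1,h3}, i.e. h and rot (rot h).\<close>
definition thread :: "('d \<Rightarrow> 'd) \<Rightarrow> 'd \<Rightarrow> 'd \<Rightarrow> bool" where
  "thread rot h h' \<longleftrightarrow> h' = rot (rot h)"

text \<open>A circuit (e_0,...,e_{k-1}), e_i = (u_i,u_{i+1}), is represented by the list of darts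
  d_i, where d_i is the end of e_i at u_i (so opp d_i is its end at u_{i+1}).
  It is threaded if at each u_{i+1} the ends opp d_i and d_{i+1} form a thread.\<close>
definition threaded_circuit :: "'d set \<Rightarrow> ('d \<Rightarrow> 'd) \<Rightarrow> ('d \<Rightarrow> 'd) \<Rightarrow> 'd list \<Rightarrow> bool" where
  "threaded_circuit D opp rot ds \<longleftrightarrow> ds \<noteq> [] \<and> set ds \<subseteq> D \<and>
     distinct (map (edge_of opp) ds) \<and>
     (\<forall>i<length ds. thread rot (opp (ds ! i)) (ds ! (Suc i mod length ds)))"

definition threaded_circuit_partition ::
  "'d set \<Rightarrow> ('d \<Rightarrow> 'd) \<Rightarrow> ('d \<Rightarrow> 'd) \<Rightarrow> 'd list set \<Rightarrow> bool" where
  "threaded_circuit_partition D opp rot C \<longleftrightarrow>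
     (\<forall>ds\<in>C. threaded_circuit D opp rot ds) \<and>
     (\<forall>d\<in>D. \<exists>!ds\<in>C. edge_of opp d \<in> set (map (edge_of opp) ds))"

text \<open>Darts of G - c, and of the subgraph induced on a vertex set W.\<close>
definition del_vertex_darts :: "'d set \<Rightarrow> ('d \<Rightarrow> 'd) \<Rightarrow> ('d \<Rightarrow> 'v) \<Rightarrow> 'v \<Rightarrow> 'd set" where
  "del_vertex_darts D opp vert c = {d\<in>D. vert d \<noteq> c \<and> vert (opp d) \<noteq> c}"

definition induced_darts :: "'d set \<Rightarrow> ('d \<Rightarrow> 'd) \<Rightarrow> ('d \<Rightarrow> 'v) \<Rightarrow> 'v set \<Rightarrow> 'd set" where
  "induced_darts D opp vert W = {d\<in>D. vert d \<in> W \<and> vert (opp d) \<in> W}"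

text \<open>Rotation induced on a subset S of darts: next dart of S in cyclic order.\<close>
definition induced_rot :: "('d \<Rightarrow> 'd) \<Rightarrow> 'd set \<Rightarrow> 'd \<Rightarrow> 'd" where
  "induced_rot rot S d = (rot ^^ (LEAST n. 0 < n \<and> (rot ^^ n) d \<in> S)) d"

text \<open>Adding one self-loop at c: old darts become Inl d, the loop has darts Inr False, Inr True.\<close>
definition add_loop_darts :: "'d set \<Rightarrow> ('d + bool) set" where
  "add_loop_darts S = Inl ` S \<union> {Inr False, Inr True}"

definition add_loop_opp :: "('d \<Rightarrow> 'd) \<Rightarrow> 'd + bool \<Rightarrow> 'd + bool" where
  "add_loop_opp opp = case_sum (\<lambda>d. Inl (opp d)) (\<lambda>b. Inr (\<not> b))"

definition add_loop_vert :: "('d \<Rightarrow> 'v) \<Rightarrow> 'v \<Rightarrow> 'd + bool \<Rightarrow> 'v" where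
  "add_loop_vert vert c = case_sum vert (\<lambda>_. c)"

definition extends_induced :: "('d \<Rightarrow> 'd) \<Rightarrow> 'd set \<Rightarrow> ('d + bool \<Rightarrow> 'd + bool) \<Rightarrow> bool" where
  "extends_induced rot S rot' \<longleftrightarrow>
     (\<forall>d\<in>S. induced_rot rot' (Inl ` S) (Inl d) = Inl (induced_rot rot S d))"

end

theory Submission
  imports Defs
begin

text \<open>The number of threaded circuits is the number of classes of darts under the relation generated by
  \<open>opp\<close> and \<open>rot \<circ> rot\<close>. By parity the cut vertex \<open>c\<close> sends exactly two darts \<open>a, a'\<close> into \<open>K1\<close> and
  two darts \<open>b, b'\<close> into \<open>K2\<close>. The two pairs cannot alternate around \<open>c\<close>: no dart at \<open>c\<close> is a bridge, so in
  genus 0 each has different faces on its two sides, whereas in an alternating rotation the face walk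
  from \<open>a\<close> would come back along \<open>a\<close>. The same argument applies to the added loops. Hence the threads
  at \<open>c\<close> join \<open>a, a'\<close> to \<open>b, b'\<close>, respectively to the two ends of the loop. Parity shows that the strand
  leaving \<open>c\<close> along \<open>a\<close> returns along \<open>a'\<close>, and likewise for \<open>b\<close>, so the two circuits through the added
  loops are fused into a single circuit through \<open>c\<close>.\<close>

section \<open>Classes of generated equivalences\<close>

text \<open>The equivalence on the whole type generated by \<open>r\<close>; points that
  \<open>r\<close> does not touch are alone in their class. For this reason \<open>classes\<close>
  takes the ground set as a separate argument.\<close>

definition conn :: "('a \<times> 'a) set \<Rightarrow> ('a \<times> 'a) set" where
  "conn r = (r \<union> r\<inverse>)\<^sup>*"

definition classes :: "'a set \<Rightarrow> ('a \<times> 'a) set \<Rightarrow> 'a set set" where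
  "classes D r = (\<lambda>x. conn r `` {x}) ` D"

text \<open>Vertices, faces, connected parts and threaded circuits all become classes of unions of
  such graphs, so one counting calculus serves them all. The maps are arbitrary off
  \<open>D\<close>, hence the restriction.\<close>

definition fgraph :: "'a set \<Rightarrow> ('a \<Rightarrow> 'b) \<Rightarrow> ('a \<times> 'b) set" where
  "fgraph D f = (\<lambda>x. (x, f x)) ` D"

lemma conn_refl [simp]: "(x, x) \<in> conn r"
  by (simp add: conn_def)

lemma conn_sym: "(x, y) \<in> conn r \<Longrightarrow> (y, x) \<in> conn r"
  unfolding conn_def by (meson symD sym_Un_converse sym_rtrancl)

lemma conn_trans: "(x, y) \<in> conn r \<Longrightarrow> (y, z) \<in> conn r \<Longrightarrow> (x, z) \<in> conn r"
  unfolding conn_def by (rule rtrancl_trans)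

lemma conn_base: "(x, y) \<in> r \<Longrightarrow> (x, y) \<in> conn r"
  by (auto simp: conn_def)

text \<open>Induction along a path: each generating step is sent to a connected pair, and the
  invariance of \<open>S\<close> keeps the path where \<open>f\<close> is controlled. With the
  identity for \<open>f\<close> it yields closure and monotonicity below.\<close>

lemma conn_mapI:
  assumes "(x, y) \<in> conn r" "x \<in> S"
    and "\<And>u v. (u, v) \<in> r \<Longrightarrow> u \<in> S \<longleftrightarrow> v \<in> S"
    and "\<And>u v. (u, v) \<in> r \<Longrightarrow> u \<in> S \<Longrightarrow> (f u, f v) \<in> conn s"
  shows "y \<in> S \<and> (f x, f y) \<in> conn s"
  using assms(1) unfolding conn_def[of r]
proof (induction rule: rtrancl_induct)
  case base
  then show ?case using assms(2) by simp
next
  case (step y z)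
  then show ?case using assms(3,4) by (metis UnE converseD conn_sym conn_trans)
qed

lemma conn_closed:
  assumes "(x, y) \<in> conn r" "x \<in> S" "\<And>u v. (u, v) \<in> r \<Longrightarrow> u \<in> S \<longleftrightarrow> v \<in> S"
  shows "y \<in> S"
  using conn_mapI[OF assms, of "\<lambda>x. x" UNIV] by (auto intro: conn_base)

lemma conn_least: "r \<subseteq> conn s \<Longrightarrow> conn r \<subseteq> conn s"
  using conn_mapI[of _ _ r UNIV "\<lambda>x. x" s] by auto

lemma conn_mono: "r \<subseteq> s \<Longrightarrow> conn r \<subseteq> conn s"
  by (rule conn_least) (auto intro: conn_base)

lemma conn_eqI: "r \<subseteq> conn s \<Longrightarrow> s \<subseteq> conn r \<Longrightarrow> conn r = conn s"
  by (simp add: conn_least subset_antisym)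

lemma conn_insert: "(x, y) \<in> conn r \<Longrightarrow> conn (insert (x, y) r) = conn r"
  by (rule conn_eqI) (auto intro: conn_base)

lemma class_eq_iff: "conn r `` {x} = conn r `` {y} \<longleftrightarrow> (x, y) \<in> conn r"
  by (auto intro: conn_trans conn_sym)

text \<open>A path that uses the new pair has each of its ends joined, by old steps, to
  \<open>x\<close> or to \<open>y\<close>.\<close>

lemma conn_insert_iff:
  "(u, v) \<in> conn (insert (x, y) r) \<longleftrightarrow> (u, v) \<in> conn r \<or>
     ((u, x) \<in> conn r \<or> (u, y) \<in> conn r) \<and> ((v, x) \<in> conn r \<or> (v, y) \<in> conn r)"
    (is "?L \<longleftrightarrow> ?R u v")
proof
  assume ?L
  then show "?R u v"
    unfolding conn_def[of "insert (x, y) r"]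
  proof (induction rule: rtrancl_induct)
    case (step v w)
    then have "(v, w) \<in> conn r \<or> (v, w) = (x, y) \<or> (v, w) = (y, x)"
      by (auto intro: conn_base conn_sym)
    with step.IH show ?case
      by (smt (verit, del_insts) Pair_inject conn_refl conn_sym conn_trans)
  qed simp
next
  let ?s = "insert (x, y) r"
  have m: "(p, q) \<in> conn r \<Longrightarrow> (p, q) \<in> conn ?s" for p q
    using conn_mono[of r ?s] by auto
  have "(x, y) \<in> conn ?s" by (auto intro: conn_base)
  moreover assume "?R u v"
  ultimately show ?L by (metis m conn_sym conn_trans)
qed

lemma card_classes_insert:
  assumes "finite D" "x \<in> D" "y \<in> D" "(x, y) \<notin> conn r"
  shows "Suc (card (classes D (insert (x, y) r))) = card (classes D r)"
proof -
  let ?c = "\<lambda>x. conn r `` {x}"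
  let ?M = "?c x \<union> ?c y"
  have new: "conn (insert (x, y) r) `` {z} = (if z \<in> ?M then ?M else ?c z)" for z
    by (auto simp: conn_insert_iff intro: conn_trans conn_sym)
  have *: "classes D (insert (x, y) r) = insert ?M (classes D r - {?c x, ?c y})"
  proof (intro set_eqI iffI)
    fix X assume "X \<in> classes D (insert (x, y) r)"
    then obtain z where "z \<in> D" "X = (if z \<in> ?M then ?M else ?c z)"
      unfolding classes_def new by auto
    moreover have "z \<notin> ?M \<Longrightarrow> ?c z \<noteq> ?c x \<and> ?c z \<noteq> ?c y"
      by (auto simp: class_eq_iff dest: conn_sym)
    ultimately show "X \<in> insert ?M (classes D r - {?c x, ?c y})"
      by (simp add: classes_def split: if_splits)
  next
    fix X assume X: "X \<in> insert ?M (classes D r - {?c x, ?c y})"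
    show "X \<in> classes D (insert (x, y) r)"
    proof (cases "X = ?M")
      case True
      then have "X = conn (insert (x, y) r) `` {x}" by (simp add: new)
      then show ?thesis using assms(2) by (auto simp: classes_def)
    next
      case False
      then obtain z where z: "z \<in> D" "X = ?c z" "X \<noteq> ?c x" "X \<noteq> ?c y"
        using X unfolding classes_def by blast
      then have "z \<notin> ?M" by (auto simp: class_eq_iff dest: conn_sym)
      then have "X = conn (insert (x, y) r) `` {z}" using z(2) by (simp add: new)
      then show ?thesis using z(1) by (auto simp: classes_def)
    qed
  qed
  \<comment> \<open>The fused class is really new, as it contains the unconnected points
    \<open>x\<close> and \<open>y\<close>; hence two classes are removed and one is added.\<close>
  have "?M \<notin> classes D r"
  proof
    assume "?M \<in> classes D r"
    then obtain z where z: "?M = ?c z" by (auto simp: classes_def)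
    have "x \<in> ?M" "y \<in> ?M" by auto
    then have "(z, x) \<in> conn r" "(z, y) \<in> conn r" unfolding z by auto
    then show False using assms(4) by (meson conn_sym conn_trans)
  qed
  moreover have fin: "finite (classes D r)" using assms(1) by (simp add: classes_def)
  ultimately have "card (classes D (insert (x, y) r)) = Suc (card (classes D r - {?c x, ?c y}))"
    unfolding * by simp
  moreover have sub: "{?c x, ?c y} \<subseteq> classes D r" using assms(2,3) by (auto simp: classes_def)
  moreover have two: "card {?c x, ?c y} = 2" using assms(4) by (simp add: class_eq_iff)
  moreover have "2 \<le> card (classes D r)" using card_mono[OF fin sub] two by simp
  ultimately show ?thesis by (simp add: card_Diff_subset)
qed

lemma card_classes_Un:
  assumes "finite D1" "finite D2" "D1 \<inter> D2 = {}"
    and "\<And>u v. (u, v) \<in> r \<Longrightarrow> u \<in> D1 \<longleftrightarrow> v \<in> D1"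
  shows "card (classes (D1 \<union> D2) r) = card (classes D1 r) + card (classes D2 r)"
proof -
  have "classes D1 r \<inter> classes D2 r = {}"
    using conn_closed[of _ _ r D1] assms(3,4) by (fastforce simp: classes_def class_eq_iff)
  moreover have "classes (D1 \<union> D2) r = classes D1 r \<union> classes D2 r"
    by (auto simp: classes_def)
  ultimately show ?thesis
    using assms(1,2) by (simp add: card_Un_disjoint classes_def)
qed

text \<open>Both maps preserve connectedness and \<open>g (p x)\<close> stays in the class of
  \<open>x\<close>, so \<open>p\<close> also reflects connectedness and induces a bijection of
  classes. It serves to collapse an added loop onto a dart at the cut vertex.\<close>

lemma card_classes_retract:
  assumes "p ` D' = D"
    and "\<And>u v. (u, v) \<in> s \<Longrightarrow> (p u, p v) \<in> conn r"
    and "\<And>u v. (u, v) \<in> r \<Longrightarrow> u \<in> D \<longleftrightarrow> v \<in> D"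
    and "\<And>u v. (u, v) \<in> r \<Longrightarrow> u \<in> D \<Longrightarrow> (g u, g v) \<in> conn s"
    and "\<And>x. x \<in> D' \<Longrightarrow> (x, g (p x)) \<in> conn s"
  shows "card (classes D' s) = card (classes D r)"
proof -
  have iff: "(x, y) \<in> conn s \<longleftrightarrow> (p x, p y) \<in> conn r" if "x \<in> D'" "y \<in> D'" for x y
  proof
    assume "(x, y) \<in> conn s"
    then show "(p x, p y) \<in> conn r"
      using conn_mapI[of x y s UNIV p r] assms(2) by simp
  next
    assume "(p x, p y) \<in> conn r"
    moreover have "p x \<in> D" using assms(1) that by auto
    ultimately have "(g (p x), g (p y)) \<in> conn s"
      using conn_mapI[of "p x" "p y" r D g s] assms(3,4) by blast
    then show "(x, y) \<in> conn s" using assms(5) that by (meson conn_sym conn_trans)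
  qed
  let ?F = "\<lambda>X. conn r `` (p ` (X \<inter> D'))"
  have F: "?F (conn s `` {x}) = conn r `` {p x}" if "x \<in> D'" for x
    using that iff by (fastforce intro: conn_trans)
  have "bij_betw ?F (classes D' s) (classes D r)"
    unfolding bij_betw_def
  proof
    show "inj_on ?F (classes D' s)"
    proof (rule inj_onI)
      fix X Y assume "X \<in> classes D' s" "Y \<in> classes D' s" and eq: "?F X = ?F Y"
      then obtain x y where xy: "x \<in> D'" "X = conn s `` {x}" "y \<in> D'" "Y = conn s `` {y}"
        by (auto simp: classes_def)
      then have "conn r `` {p x} = conn r `` {p y}" using F eq by simp
      then show "X = Y" using iff xy by (simp add: class_eq_iff)
    qed
    show "?F ` classes D' s = classes D r"
      using F assms(1) by (force simp: classes_def image_image)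
  qed
  then show ?thesis by (rule bij_betw_same_card)
qed

section \<open>Orbits of a permutation of a finite set\<close>

lemma funpow_closed: "bij_betw f D D \<Longrightarrow> x \<in> D \<Longrightarrow> (f ^^ n) x \<in> D"
  by (induction n) (auto simp: bij_betw_def)

lemma conn_fgraph_funpow:
  assumes "bij_betw f D D" "x \<in> D" shows "(x, (f ^^ n) x) \<in> conn (fgraph D f)"
proof (induction n)
  case (Suc n)
  have "((f ^^ n) x, f ((f ^^ n) x)) \<in> conn (fgraph D f)"
    using funpow_closed[OF assms] by (auto simp: fgraph_def intro: conn_base)
  then show ?case using Suc by (auto intro: conn_trans)
qed simp

text \<open>An injective self-map of a finite set is onto, so \<open>f\<close> has no way into
  \<open>S\<close> from outside. Forward invariance therefore gives the two-sided invariance that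
  \<open>conn\<close> requires.\<close>

lemma invariant_preimage:
  assumes "bij_betw f D D" "finite D" "S \<subseteq> D" "f ` S \<subseteq> S" "x \<in> D" "f x \<in> S"
  shows "x \<in> S"
proof -
  have "inj_on f S" using assms by (meson bij_betw_imp_inj_on inj_on_subset)
  then have "f ` S = S" using assms by (meson endo_inj_surj finite_subset)
  then obtain u where "u \<in> S" "f x = f u" using assms(6) by auto
  then show ?thesis using assms by (metis bij_betw_imp_inj_on inj_onD subsetD)
qed

lemma conn_fgraph_closed:
  assumes "bij_betw f D D" "finite D" "S \<subseteq> D" "f ` S \<subseteq> S" "(x, y) \<in> conn (fgraph D f)" "x \<in> S"
  shows "y \<in> S"
  using conn_closed[OF assms(5,6)] invariant_preimage[OF assms(1-4)] assms(4)
  by (auto simp: fgraph_def)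

lemma conn_fgraph_iff:
  assumes "bij_betw f D D" "finite D" "x \<in> D"
  shows "(x, y) \<in> conn (fgraph D f) \<longleftrightarrow> (\<exists>n. y = (f ^^ n) x)"
proof
  let ?S = "{(f ^^ n) x | n. True}"
  have "?S \<subseteq> D" using funpow_closed assms by fastforce
  moreover have "f ` ?S \<subseteq> ?S" by (auto intro: exI[of _ "Suc _"])
  moreover have "x \<in> ?S" by (auto intro: exI[of _ 0])
  moreover assume "(x, y) \<in> conn (fgraph D f)"
  ultimately show "\<exists>n. y = (f ^^ n) x"
    using conn_fgraph_closed[OF assms(1,2)] by blast
next
  assume "\<exists>n. y = (f ^^ n) x"
  then show "(x, y) \<in> conn (fgraph D f)" using conn_fgraph_funpow[OF assms(1,3)] by auto
qed

section \<open>The genus inequality\<close>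

text \<open>The new function is \<open>f\<close> precomposed with the transposition of
  \<open>x\<close> and \<open>y\<close>. The lemmas that follow establish its classical effect: two
  cycles merge, or one cycle splits.\<close>

lemma bij_betw_swapped:
  assumes "bij_betw f D D" "finite D" "x \<in> D" "y \<in> D"
  shows "bij_betw (f(x := f y, y := f x)) D D"
proof -
  have "inj_on (f(x := f y, y := f x)) D"
    using bij_betw_imp_inj_on[OF assms(1)] assms(3,4) unfolding inj_on_def by (auto split: if_splits)
  moreover have "(f(x := f y, y := f x)) ` D \<subseteq> D"
    using assms by (auto simp: bij_betw_def)
  ultimately show ?thesis using endo_inj_surj[OF assms(2)] unfolding bij_betw_def by blast
qed

text \<open>The new orbit of \<open>x\<close> jumps to \<open>f y\<close> and then follows the old
  cycle of \<open>y\<close>, on which \<open>x\<close> does not occur, until it reaches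
  \<open>y\<close>.\<close>

lemma conn_swapped_merge:
  assumes "bij_betw f D D" "finite D" "x \<in> D" "y \<in> D" "(x, y) \<notin> conn (fgraph D f)"
  shows "conn (fgraph D (f(x := f y, y := f x))) = conn (insert (x, y) (fgraph D f))"
    (is "conn ?g = conn ?h")
proof -
  let ?f' = "f(x := f y, y := f x)"
  have ne: "x \<noteq> y" using assms(5) by auto
  have g: "z \<in> D \<Longrightarrow> (z, ?f' z) \<in> conn ?g" for z
    by (auto simp: fgraph_def intro!: conn_base)
  have gx: "(x, f y) \<in> conn ?g" using g[of x] ne assms(3) by simp
  have gy: "(y, f x) \<in> conn ?g" using g[of y] assms(4) by simp
  \<comment> \<open>The exponent starts at one because the walk enters the cycle at
    \<open>f y\<close>, not at \<open>y\<close>.\<close>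
  have step: "(x, (f ^^ Suc i) y) \<in> conn ?g" for i
  proof (induction i)
    case (Suc i)
    let ?u = "(f ^^ Suc i) y"
    have u: "?u \<in> D" "(y, ?u) \<in> conn (fgraph D f)"
      using funpow_closed conn_fgraph_funpow assms by metis+
    then have "?u \<noteq> x" using assms(5) conn_sym by metis
    show ?case
    proof (cases "?u = y")
      case True
      then have "(f ^^ Suc (Suc i)) y = f y" by simp
      then show ?thesis using gx by (simp only:)
    next
      case False
      then have "(?u, f ?u) \<in> conn ?g" using g[OF u(1)] \<open>?u \<noteq> x\<close> by simp
      from conn_trans[OF Suc this] show ?thesis by (simp only: funpow.simps comp_apply)
    qed
  next
    case 0
    show ?case using gx by (simp only: funpow.simps comp_apply id_apply)
  qed
  have "f y \<in> D" using assms by (auto simp: bij_betw_def)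
  moreover have "(f y, y) \<in> conn (fgraph D f)"
    using assms(4) by (auto simp: fgraph_def intro!: conn_sym[OF conn_base])
  ultimately obtain n where "y = (f ^^ n) (f y)"
    using conn_fgraph_iff[OF assms(1,2)] by blast
  then have "(x, y) \<in> conn ?g"
    using step[of n] by (metis comp_apply funpow_Suc_right)
  then have xy: "(x, y) \<in> conn ?g" "(y, x) \<in> conn ?g" by (auto dest: conn_sym)
  show ?thesis
  proof (rule conn_eqI)
    have h: "z \<in> D \<Longrightarrow> (z, f z) \<in> conn ?h" for z
      by (auto simp: fgraph_def intro!: conn_base)
    have "(x, y) \<in> conn ?h" "(y, x) \<in> conn ?h" by (auto intro: conn_base conn_sym)
    with h have "(x, f y) \<in> conn ?h" "(y, f x) \<in> conn ?h"
      using assms(3,4) conn_trans by metis+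
    with h show "?g \<subseteq> conn ?h" by (auto simp: fgraph_def)
    have "(x, f x) \<in> conn ?g" "(y, f y) \<in> conn ?g" using xy gx gy conn_trans by metis+
    moreover have "z \<in> D \<Longrightarrow> z \<noteq> x \<Longrightarrow> z \<noteq> y \<Longrightarrow> (z, f z) \<in> conn ?g" for z
      using g[of z] by simp
    ultimately show "?h \<subseteq> conn ?g" using xy by (auto simp: fgraph_def)
  qed
qed

text \<open>The old arc from \<open>f x\<close> to the first occurrence of \<open>y\<close> is
  invariant under the new permutation, since \<open>y\<close> is now sent back to
  \<open>f x\<close>; it contains \<open>y\<close> but not \<open>x\<close>.\<close>

lemma conn_swapped_split:
  assumes "bij_betw f D D" "finite D" "x \<in> D" "y \<in> D" "x \<noteq> y" "(x, y) \<in> conn (fgraph D f)"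
  shows "(x, y) \<notin> conn (fgraph D (f(x := f y, y := f x)))"
proof
  let ?f' = "f(x := f y, y := f x)"
  define k where "k = (LEAST k. (f ^^ k) x = y)"
  have "\<exists>k. (f ^^ k) x = y" using conn_fgraph_iff[OF assms(1-3)] assms(6) by metis
  then have k: "(f ^^ k) x = y" unfolding k_def by (rule LeastI_ex)
  have kmin: "k \<le> j" if "(f ^^ j) x = y" for j using that unfolding k_def by (rule Least_le)
  have "k > 0" using k assms(5) by (cases k) auto
  let ?S = "(\<lambda>j. (f ^^ j) x) ` {0<..k}"
  \<comment> \<open>A return to \<open>x\<close> at time \<open>j\<close> would bring
    \<open>y\<close> forward to time \<open>k - j\<close>, against the minimality of
    \<open>k\<close>.\<close>
  have "x \<notin> ?S"
  proof
    assume "x \<in> ?S"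
    then obtain j where j: "0 < j" "j \<le> k" "(f ^^ j) x = x" by force
    then have "(f ^^ (k - j)) x = y"
      using k by (metis comp_apply funpow_add le_add_diff_inverse2)
    then show False using kmin j by fastforce
  qed
  moreover have "y \<in> ?S" using k \<open>k > 0\<close> by force
  moreover have "?S \<subseteq> D" using funpow_closed[OF assms(1,3)] by auto
  moreover have "?f' ` ?S \<subseteq> ?S"
  proof
    fix v assume "v \<in> ?f' ` ?S"
    then obtain j where j: "0 < j" "j \<le> k" "v = ?f' ((f ^^ j) x)" by auto
    show "v \<in> ?S"
    proof (cases "j = k")
      case True
      then have "v = (f ^^ 1) x" using j k by simp
      then show ?thesis using \<open>k > 0\<close> by force
    next
      case False
      then have "(f ^^ j) x \<noteq> y" using kmin j by force
      moreover have "(f ^^ j) x \<noteq> x" using \<open>x \<notin> ?S\<close> j by force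
      ultimately have "v = (f ^^ Suc j) x" using j by simp
      moreover have "Suc j \<in> {0<..k}" using j False by simp
      ultimately show ?thesis by (rule image_eqI)
    qed
  qed
  moreover assume "(x, y) \<in> conn (fgraph D ?f')"
  ultimately show False
    using conn_fgraph_closed[OF bij_betw_swapped[OF assms(1-4)] assms(2)] conn_sym by metis
qed

lemma card_classes_merge:
  assumes "bij_betw f D D" "finite D" "x \<in> D" "y \<in> D" "(x, y) \<notin> conn (fgraph D f)"
  shows "Suc (card (classes D (fgraph D (f(x := f y, y := f x))))) = card (classes D (fgraph D f))"
  using card_classes_insert[OF assms(2-5)] conn_swapped_merge[OF assms] by (simp add: classes_def)

text \<open>Swapping the two values again restores \<open>f\<close>, so this is the merge count read
  backwards, now that \<open>x\<close> and \<open>y\<close> lie in different cycles.\<close>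

lemma card_classes_split:
  assumes "bij_betw f D D" "finite D" "x \<in> D" "y \<in> D" "x \<noteq> y" "(x, y) \<in> conn (fgraph D f)"
  shows "card (classes D (fgraph D (f(x := f y, y := f x)))) = Suc (card (classes D (fgraph D f)))"
proof -
  let ?g = "f(x := f y, y := f x)"
  have "?g(x := ?g y, y := ?g x) = f" using assms(5) by auto
  then show ?thesis
    using card_classes_merge[OF bij_betw_swapped[OF assms(1-4)] assms(2-4) conn_swapped_split[OF assms]]
    by simp
qed

lemma edge_of_eq_or_disjoint:
  assumes "opp (opp d) = d" "opp (opp e) = e"
  shows "edge_of opp d = edge_of opp e \<or> edge_of opp d \<inter> edge_of opp e = {}"
proof -
  have "opp d = opp e \<longleftrightarrow> d = e" "d = opp e \<longleftrightarrow> opp d = e" using assms by metis+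
  then show ?thesis unfolding edge_of_def by (cases "d = e") auto
qed

text \<open>This is V + F \<le> 2 C + E, with \<open>\<sigma>\<close> as the rotation and the edges
  of \<open>E\<close> switched on one by one; a dart that is still off is fixed by the partial
  \<open>opp\<close>. Without edges the faces are the cycles of \<open>\<sigma>\<close> and equality
  holds. An edge inside one connected part raises F by at most one, while E grows by one; an edge
  between two parts lowers F and C by one each, so both sides drop by one. Bijectivity is carried
  along for the swap lemmas.\<close>

lemma genus_inequality:
  assumes "finite D" "bij_betw \<sigma> D D"
    and opp: "\<forall>d\<in>D. opp d \<in> D \<and> opp (opp d) = d \<and> opp d \<noteq> d"
    and "finite E" "E \<subseteq> edge_of opp ` D"
  shows "bij_betw (\<lambda>d. \<sigma> (if d \<in> \<Union>E then opp d else d)) D D \<and>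
    card (classes D (fgraph D \<sigma>)) + card (classes D (fgraph D (\<lambda>d. \<sigma> (if d \<in> \<Union>E then opp d else d))))
      \<le> 2 * card (classes D (fgraph D \<sigma> \<union> fgraph (\<Union>E) opp)) + card E"
  using assms(4,5)
proof (induction rule: finite_induct)
  case empty
  then show ?case using assms(2) by (simp add: fgraph_def)
next
  case (insert e E)
  let ?\<rho> = "\<lambda>E d. \<sigma> (if d \<in> \<Union>E then opp d else d)"
  let ?R = "\<lambda>E. fgraph D \<sigma> \<union> fgraph (\<Union>E) opp"
  have bij: "bij_betw (?\<rho> E) D D" using insert by simp
  obtain d where d: "d \<in> D" "e = edge_of opp d" using insert.prems by auto
  have d': "opp d \<in> D" "opp (opp d) = d" "d \<noteq> opp d" using opp d(1) by metis+
  have "e \<inter> e' = {}" if e': "e' \<in> E" for e'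
  proof -
    obtain d2 where "d2 \<in> D" "e' = edge_of opp d2" using insert.prems e' by auto
    then show ?thesis
      using edge_of_eq_or_disjoint[of opp d d2] opp d e' insert.hyps(2) by auto
  qed
  then have "e \<inter> \<Union>E = {}" by blast
  then have new: "d \<notin> \<Union>E" "opp d \<notin> \<Union>E" using d(2) by (auto simp: edge_of_def)
  \<comment> \<open>Both darts were fixed so far, so switching on their edge precomposes the face
    permutation with their transposition.\<close>
  have \<rho>: "?\<rho> (insert e E) = (?\<rho> E)(d := ?\<rho> E (opp d), opp d := ?\<rho> E d)"
    using new d' by (auto simp: d(2) edge_of_def fun_eq_iff)
  have bij': "bij_betw (?\<rho> (insert e E)) D D"
    unfolding \<rho> by (rule bij_betw_swapped[OF bij assms(1) d(1) d'(1)])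
  have "conn (?R (insert e E)) = conn (insert (d, opp d) (?R E))"
  proof (rule conn_eqI)
    have "(opp d, d) \<in> conn (insert (d, opp d) (?R E))" by (auto intro: conn_base conn_sym)
    then show "?R (insert e E) \<subseteq> conn (insert (d, opp d) (?R E))"
      by (auto simp: d(2) edge_of_def fgraph_def d' intro: conn_base)
    show "insert (d, opp d) (?R E) \<subseteq> conn (?R (insert e E))"
      by (auto simp: d(2) edge_of_def fgraph_def d' intro: conn_base)
  qed
  then have R: "classes D (?R (insert e E)) = classes D (insert (d, opp d) (?R E))"
    by (simp add: classes_def)
  \<comment> \<open>A face never leaves its connected part; hence an edge that joins two parts also
    joins two faces.\<close>
  have sub: "conn (fgraph D (?\<rho> E)) \<subseteq> conn (?R E)"
  proof (rule conn_least)
    have "(z, ?\<rho> E z) \<in> conn (?R E)" if "z \<in> D" for z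
    proof (cases "z \<in> \<Union>E")
      case True
      then have "(z, opp z) \<in> conn (?R E)" by (auto simp: fgraph_def intro!: conn_base)
      moreover have "(opp z, \<sigma> (opp z)) \<in> conn (?R E)"
        using opp that by (auto simp: fgraph_def intro!: conn_base)
      ultimately show ?thesis using True by (auto intro: conn_trans)
    next
      case False
      then show ?thesis using that by (auto simp: fgraph_def intro!: conn_base)
    qed
    then show "fgraph D (?\<rho> E) \<subseteq> conn (?R E)" by (auto simp: fgraph_def)
  qed
  have IH: "card (classes D (fgraph D \<sigma>)) + card (classes D (fgraph D (?\<rho> E)))
      \<le> 2 * card (classes D (?R E)) + card E"
    using insert by simp
  have cE: "card (insert e E) = Suc (card E)" using insert.hyps by simp
  show ?case
  proof (cases "(d, opp d) \<in> conn (?R E)")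
    case True
    then have "card (classes D (?R (insert e E))) = card (classes D (?R E))"
      unfolding R by (simp add: classes_def conn_insert)
    moreover have "card (classes D (fgraph D (?\<rho> (insert e E)))) \<le> Suc (card (classes D (fgraph D (?\<rho> E))))"
      unfolding \<rho> using card_classes_merge[OF bij assms(1) d(1) d'(1)]
        card_classes_split[OF bij assms(1) d(1) d'(1,3)] by linarith
    ultimately show ?thesis using IH cE bij' by linarith
  next
    case False
    then have "Suc (card (classes D (?R (insert e E)))) = card (classes D (?R E))"
      unfolding R using card_classes_insert[OF assms(1) d(1) d'(1)] by blast
    moreover have "Suc (card (classes D (fgraph D (?\<rho> (insert e E))))) = card (classes D (fgraph D (?\<rho> E)))"
      unfolding \<rho> using card_classes_merge[OF bij assms(1) d(1) d'(1)] sub False by blast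
    ultimately show ?thesis using IH cE bij' by linarith
  qed
qed

section \<open>Four-regular maps\<close>

lemma even_card_involution:
  assumes "finite X" "\<And>x. x \<in> X \<Longrightarrow> f x \<in> X \<and> f (f x) = x \<and> f x \<noteq> x"
  shows "even (card X)"
proof -
  have "2 * card (edge_of f ` X) = card (\<Union>(edge_of f ` X))"
  proof (rule card_partition)
    show "finite (edge_of f ` X)" using assms(1) by simp
    show "finite (\<Union>(edge_of f ` X))" using assms(1) by (auto simp: edge_of_def)
    show "card e = 2" if e: "e \<in> edge_of f ` X" for e
    proof -
      obtain x where "x \<in> X" "e = {x, f x}" using e by (auto simp: edge_of_def)
      moreover from this have "x \<noteq> f x" using assms(2) by metis
      ultimately show ?thesis by simp
    qed
    show "e1 \<inter> e2 = {}" if e: "e1 \<in> edge_of f ` X" "e2 \<in> edge_of f ` X" "e1 \<noteq> e2" for e1 e2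
    proof -
      obtain x y where "x \<in> X" "y \<in> X" "e1 = edge_of f x" "e2 = edge_of f y"
        using e(1,2) by auto
      then show ?thesis using edge_of_eq_or_disjoint[of f x y] assms(2) e(3) by auto
    qed
  qed
  moreover have "\<Union>(edge_of f ` X) = X" using assms(2) by (auto simp: edge_of_def)
  ultimately show ?thesis by (metis dvd_triv_left)
qed

locale four_regular_map =
  fixes V :: "'v set" and D :: "'d set" and opp :: "'d \<Rightarrow> 'd" and vert :: "'d \<Rightarrow> 'v"
    and rot :: "'d \<Rightarrow> 'd"
  assumes dart: "dart_graph V D opp vert"
    and rs: "rotation_system D vert rot"
    and reg: "four_regular V D vert"
begin

lemma finD: "finite D" and finV: "finite V"
  using dart by (auto simp: dart_graph_def)

lemma opp: "d \<in> D \<Longrightarrow> opp d \<in> D" "d \<in> D \<Longrightarrow> opp (opp d) = d" "d \<in> D \<Longrightarrow> opp d \<noteq> d"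
  and vert: "d \<in> D \<Longrightarrow> vert d \<in> V"
  using dart by (auto simp: dart_graph_def)

lemma rot_bij: "bij_betw rot D D"
  using rs by (simp add: rotation_system_def)

lemma rot: "d \<in> D \<Longrightarrow> rot d \<in> D" "d \<in> D \<Longrightarrow> vert (rot d) = vert d"
  using rs by (auto simp: rotation_system_def bij_betw_def)

lemma rot_inj: "d \<in> D \<Longrightarrow> d' \<in> D \<Longrightarrow> rot d = rot d' \<longleftrightarrow> d = d'"
  using rot_bij by (auto simp: bij_betw_def inj_on_def)

lemma same_vert: "d \<in> D \<Longrightarrow> d' \<in> D \<Longrightarrow> vert d = vert d' \<Longrightarrow> \<exists>n. (rot ^^ n) d = d'"
  using rs by (auto simp: rotation_system_def)

text \<open>\<open>rot\<close> is transitive on the four darts of the vertex, so the orbit of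
  \<open>d\<close> cannot close before four steps. This makes it a 4-cycle, and
  \<open>rot \<circ> rot\<close> an involution without fixed points.\<close>

lemma darts_at:
  assumes "d \<in> D"
  shows "{d' \<in> D. vert d' = vert d} = {d, rot d, rot (rot d), rot (rot (rot d))}"
    and "distinct [d, rot d, rot (rot d), rot (rot (rot d))]"
    and "rot (rot (rot (rot d))) = d"
proof -
  let ?O = "{d' \<in> D. vert d' = vert d}"
  let ?S = "{d, rot d, rot (rot d), rot (rot (rot d))}"
  have card: "card ?O = 4" using reg vert[OF assms] by (auto simp: four_regular_def)
  have sub: "?S \<subseteq> ?O" using assms rot by simp
  have small: "4 \<le> i" if i: "(rot ^^ i) d = d" "i > 0" for i
  proof -
    have "?O \<subseteq> (\<lambda>n. (rot ^^ n) d) ` {..<i}"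
    proof
      fix d' assume "d' \<in> ?O"
      then obtain n where "(rot ^^ n) d = d'" using same_vert assms by force
      then have "(rot ^^ (n mod i)) d = d'" using i(1) by (simp add: funpow_mod_eq)
      then show "d' \<in> (\<lambda>n. (rot ^^ n) d) ` {..<i}" using i(2) by force
    qed
    then show ?thesis using surj_card_le[of "{..<i}" ?O] card by simp
  qed
  have in_D: "rot d \<in> D" "rot (rot d) \<in> D" "rot (rot (rot d)) \<in> D" using rot(1) assms by auto
  have ne: "d \<noteq> rot d" "d \<noteq> rot (rot d)" "d \<noteq> rot (rot (rot d))"
    using small[of 1] small[of 2] small[of 3] by (auto simp: numeral_eq_Suc)
  then show dist: "distinct [d, rot d, rot (rot d), rot (rot (rot d))]"
    using in_D assms by (simp add: rot_inj)
  then have "card ?S = 4" by simp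
  then show eq: "?O = ?S" using card_subset_eq[OF _ sub] card finD by simp
  have "rot (rot (rot (rot d))) \<in> ?S"
    unfolding eq[symmetric] using in_D assms rot by simp
  then show "rot (rot (rot (rot d))) = d" using in_D assms ne by (simp add: rot_inj)
qed

lemma rot2: "d \<in> D \<Longrightarrow> rot (rot d) \<noteq> d" "d \<in> D \<Longrightarrow> rot (rot (rot (rot d))) = d"
  using darts_at(2,3)[of d] by auto

lemma ex_dart:
  assumes "v \<in> V" shows "\<exists>d\<in>D. vert d = v"
proof (rule ccontr)
  assume "\<not> ?thesis"
  then have none: "{d \<in> D. vert d = v} = {}" by blast
  have "card {d \<in> D. vert d = v} = 4" using assms reg by (simp only: four_regular_def)
  then show False unfolding none by simp
qed

lemma conn_rot_iff:
  assumes "d \<in> D"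
  shows "(d, d') \<in> conn (fgraph D rot) \<longleftrightarrow> d' \<in> D \<and> vert d' = vert d"
proof
  assume "(d, d') \<in> conn (fgraph D rot)"
  then have "d' \<in> {d' \<in> D. vert d' = vert d}"
    using conn_fgraph_closed[OF rot_bij finD, of "{d' \<in> D. vert d' = vert d}" d d'] rot assms
    by (simp add: image_subset_iff)
  then show "d' \<in> D \<and> vert d' = vert d" by simp
next
  assume "d' \<in> D \<and> vert d' = vert d"
  then obtain n where "d' = (rot ^^ n) d" using same_vert assms by metis
  then show "(d, d') \<in> conn (fgraph D rot)" using conn_fgraph_funpow[OF rot_bij assms] by simp
qed

lemma card_vertices: "card (classes D (fgraph D rot)) = card V"
proof -
  have "classes D (fgraph D rot) = (\<lambda>v. {d \<in> D. vert d = v}) ` V"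
  proof -
    have "conn (fgraph D rot) `` {d} = {d' \<in> D. vert d' = vert d}" if "d \<in> D" for d
      using conn_rot_iff[OF that] by auto
    moreover have "V = vert ` D" using ex_dart vert by auto
    ultimately show ?thesis by (simp add: classes_def image_image)
  qed
  moreover have "inj_on (\<lambda>v. {d \<in> D. vert d = v}) V"
    by (rule inj_onI) (use ex_dart in blast)
  ultimately show ?thesis by (simp add: card_image)
qed

section \<open>Faces, bridges and genus zero\<close>

lemma face_bij: "bij_betw (rot \<circ> opp) D D"
proof -
  have "inj_on opp D" using opp(2) by (metis inj_onI)
  then have "bij_betw opp D D" using opp by (simp add: bij_betw_def endo_inj_surj finD image_subsetI)
  then show ?thesis using rot_bij by (rule bij_betw_trans)
qed

lemma faces_eq_classes: "faces D opp rot = classes D (fgraph D (rot \<circ> opp))"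
proof -
  have "conn (fgraph D (rot \<circ> opp)) `` {d} = {((rot \<circ> opp) ^^ n) d | n. True}" if "d \<in> D" for d
    using conn_fgraph_iff[OF face_bij finD that] by auto
  then show ?thesis by (simp add: faces_def classes_def)
qed

text \<open>Its classes are the connected parts, in terms of darts, of the graph without the edge of
  \<open>d\<close>; the two darts of that edge stay at their vertices through \<open>rot\<close>. A
  single class means that the edge is not a bridge.\<close>

definition edges_except :: "'d \<Rightarrow> ('d \<times> 'd) set" where
  "edges_except d = fgraph D rot \<union> fgraph (D - {d, opp d}) opp"

text \<open>If the edge had the same face on both sides, deleting it would split that face and keep
  the graph connected. This raises V - E + F by two, beyond what the genus inequality
  allows.\<close>

lemma two_faces_at_nonbridge:
  assumes plane: "plane_map V D opp vert rot" and d: "d \<in> D"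
    and nonbridge: "\<And>x y. x \<in> D \<Longrightarrow> y \<in> D \<Longrightarrow> (x, y) \<in> conn (edges_except d)"
  shows "(d, opp d) \<notin> conn (fgraph D (rot \<circ> opp))"
proof
  assume same: "(d, opp d) \<in> conn (fgraph D (rot \<circ> opp))"
  let ?E = "edge_of opp ` D - {edge_of opp d}"
  have UE: "\<Union>?E = D - {d, opp d}"
  proof -
    have eq: "edge_of opp x = edge_of opp d \<longleftrightarrow> x = d \<or> x = opp d" if "x \<in> D" for x
      using opp(2)[OF that] opp(2)[OF d] by (auto simp: edge_of_def doubleton_eq_iff)
    show ?thesis
    proof (intro set_eqI iffI)
      fix z assume "z \<in> \<Union>?E"
      then obtain x where x: "x \<in> D" "edge_of opp x \<noteq> edge_of opp d" "z = x \<or> z = opp x"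
        by (auto simp: edge_of_def)
      then have "edge_of opp z = edge_of opp x" "z \<in> D"
        using opp(1,2)[OF x(1)] by (auto simp: edge_of_def)
      then show "z \<in> D - {d, opp d}" using eq[of z] x(2) by auto
    next
      fix z assume z: "z \<in> D - {d, opp d}"
      then have "edge_of opp z \<in> ?E" using eq[of z] by auto
      then show "z \<in> \<Union>?E" by (rule UnionI) (simp add: edge_of_def)
    qed
  qed
  let ?\<rho> = "\<lambda>x. rot (if x \<in> \<Union>?E then opp x else x)"
  have fE: "finite (edge_of opp ` D)" using finD by simp
  have inv: "\<forall>d\<in>D. opp d \<in> D \<and> opp (opp d) = d \<and> opp d \<noteq> d" using opp by blast
  have gen: "card V + card (classes D (fgraph D ?\<rho>))
      \<le> 2 * card (classes D (fgraph D rot \<union> fgraph (\<Union>?E) opp)) + card ?E"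
    using genus_inequality[OF finD rot_bij inv, of ?E] fE card_vertices by auto
  \<comment> \<open>Leaving out \<open>opp\<close> at the two darts of the edge amounts to
    transposing them in the face permutation, so the split lemma counts the faces after
    deletion.\<close>
  have "fgraph D ?\<rho> = fgraph D ((rot \<circ> opp)(d := (rot \<circ> opp) (opp d), opp d := (rot \<circ> opp) d))"
    unfolding UE fgraph_def using opp d by (intro image_cong) auto
  then have F: "card (classes D (fgraph D ?\<rho>)) = Suc (card (faces D opp rot))"
    using card_classes_split[OF face_bij finD d opp(1)[OF d] opp(3)[OF d, symmetric] same]
    by (simp add: faces_eq_classes)
  have one: "card (classes D (fgraph D rot \<union> fgraph (\<Union>?E) opp)) = 1"
  proof -
    have "classes D (edges_except d) = {conn (edges_except d) `` {d}}"
    proof -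
      have "conn (edges_except d) `` {x} = conn (edges_except d) `` {d}" if "x \<in> D" for x
        using nonbridge[OF that d] by (simp add: class_eq_iff)
      then have "classes D (edges_except d) = (\<lambda>x. conn (edges_except d) `` {d}) ` D"
        unfolding classes_def by (intro image_cong) simp_all
      then show ?thesis using image_constant[OF d] by simp
    qed
    then show ?thesis unfolding UE edges_except_def by simp
  qed
  have E: "Suc (card ?E) = card (edge_of opp ` D)"
    using fE d by (metis card.remove image_eqI)
  have "isolated V D vert = {}" using ex_dart by (auto simp: isolated_def)
  then have euler: "int (card V) - int (card (edge_of opp ` D)) + int (card (faces D opp rot))
       = 2 * int (card (components V D opp vert))"
    using plane by (simp add: plane_map_def)
  have "V \<noteq> {}" using vert d by auto
  then have "card (components V D opp vert) > 0" using finV by (simp add: components_def card_gt_0_iff)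
  then show False using gen F one E euler by linarith
qed

text \<open>Otherwise the darts of \<open>P\<close> reached from \<open>z\<close> would be permuted by the face permutation, and the
  predecessor of \<open>z\<close> among them would be opposite to a dart at \<open>c\<close>.\<close>

lemma face_walk_returns:
  assumes P: "P \<subseteq> D" "\<And>d. d \<in> P \<Longrightarrow> opp d \<in> P" "\<And>d. d \<in> P \<Longrightarrow> vert d \<noteq> c \<Longrightarrow> rot d \<in> P"
    and z: "z \<in> P" "vert z = c"
  shows "\<exists>w\<in>P. vert w = c \<and> (z, opp w) \<in> conn (fgraph D (rot \<circ> opp))"
proof (rule ccontr)
  assume none: "\<not> ?thesis"
  let ?S = "{u \<in> P. (z, u) \<in> conn (fgraph D (rot \<circ> opp))}"
  have away: "vert (opp u) \<noteq> c" if "u \<in> ?S" for u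
    using that none P(1,2) opp(2) by (metis (mono_tags, lifting) mem_Collect_eq subsetD)
  have sub: "(rot \<circ> opp) ` ?S \<subseteq> ?S"
  proof
    fix v assume "v \<in> (rot \<circ> opp) ` ?S"
    then obtain u where u: "u \<in> ?S" "v = rot (opp u)" by auto
    have "(u, v) \<in> fgraph D (rot \<circ> opp)" using u P(1) by (auto simp: fgraph_def)
    then have "(z, v) \<in> conn (fgraph D (rot \<circ> opp))"
      using u(1) by (blast intro: conn_trans conn_base)
    then show "v \<in> ?S" using P(2,3) u away by auto
  qed
  moreover have "inj_on (rot \<circ> opp) ?S"
    by (rule inj_on_subset[OF bij_betw_imp_inj_on[OF face_bij]]) (use P(1) in auto)
  moreover have "finite ?S" using P(1) finD by (auto intro: finite_subset)
  ultimately have "(rot \<circ> opp) ` ?S = ?S" by (simp only: endo_inj_surj)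
  moreover have "z \<in> ?S" using z by simp
  ultimately obtain u where "u \<in> ?S" "z = rot (opp u)" by (metis (no_types, lifting) comp_apply imageE)
  moreover from this have "vert z = vert (opp u)" using rot(2) P opp(1) by auto
  ultimately show False using away z by auto
qed

text \<open>A face walk that enters \<open>A\<close> or its complement at \<open>c\<close> must come
  back to \<open>c\<close>, and by the two-face lemma not along the edge it left by. If the sides
  alternate, these forced returns lead from \<open>x\<close> to \<open>opp x\<close>.
  \<open>A\<close> is kept abstract so that the lemma covers both the cut vertex and the added
  loops.\<close>

lemma no_alternation:
  assumes plane: "plane_map V D opp vert rot"
    and A: "A \<subseteq> D" "\<And>d. d \<in> A \<Longrightarrow> opp d \<in> A" "\<And>d. d \<in> D \<Longrightarrow> vert d \<noteq> c \<Longrightarrow> rot d \<in> A \<longleftrightarrow> d \<in> A"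
    and x: "x \<in> D" "{d \<in> A. vert d = c} = {x, rot (rot x)}"
    and nonbridge: "\<And>d x y. d \<in> D \<Longrightarrow> vert d = c \<Longrightarrow> x \<in> D \<Longrightarrow> y \<in> D \<Longrightarrow> (x, y) \<in> conn (edges_except d)"
  shows False
proof -
  let ?\<phi> = "fgraph D (rot \<circ> opp)"
  have two: "(d, opp d) \<notin> conn ?\<phi>" if "d \<in> D" "vert d = c" for d
    by (rule two_faces_at_nonbridge[OF plane that(1) nonbridge[OF that]])
  have \<phi>: "(opp d, rot d) \<in> conn ?\<phi>" if "d \<in> D" for d
    using that opp by (force simp: fgraph_def intro!: conn_base)
  define y x' y' where "y = rot x" and "x' = rot y" and "y' = rot x'"
  have xc: "vert x = c" using x(2) by auto
  have D: "y \<in> D" "x' \<in> D" "y' \<in> D" "vert y = c" "vert x' = c" "vert y' = c" "rot y' = x"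
    using rot x(1) xc darts_at(3)[OF x(1)] by (simp_all add: y_def x'_def y'_def)
  have Ac: "{d \<in> A. vert d = c} = {x, x'}" using x(2) by (simp add: x'_def y_def)
  have "{d \<in> D. vert d = c} = {x, y, x', y'}" "distinct [x, y, x', y']"
    using darts_at(1,2)[OF x(1)] xc by (simp_all add: y_def x'_def y'_def)
  then have Bc: "{d \<in> D - A. vert d = c} = {y, y'}"
  proof -
    have "{d \<in> D - A. vert d = c} = {d \<in> D. vert d = c} - {d \<in> A. vert d = c}" by blast
    then show ?thesis
      using \<open>{d \<in> D. vert d = c} = _\<close> \<open>distinct _\<close> unfolding Ac by auto
  qed
  have wA: "(z, opp x) \<in> conn ?\<phi> \<or> (z, opp x') \<in> conn ?\<phi>" if "z \<in> {x, x'}" for z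
  proof -
    have z: "z \<in> A" "vert z = c" using that Ac by auto
    have "rot d \<in> A" if "d \<in> A" "vert d \<noteq> c" for d using A that by blast
    from face_walk_returns[OF A(1,2) this z] obtain w where
      w: "w \<in> A" "vert w = c" "(z, opp w) \<in> conn ?\<phi>" by blast
    then have "w \<in> {x, x'}" using Ac by blast
    then show ?thesis using w(3) by blast
  qed
  have wB: "(z, opp y) \<in> conn ?\<phi> \<or> (z, opp y') \<in> conn ?\<phi>" if "z \<in> {y, y'}" for z
  proof -
    have z: "z \<in> D - A" "vert z = c" using that Bc by auto
    have o: "opp d \<in> D - A" if "d \<in> D - A" for d
      using that opp(1,2)[of d] A(2)[of "opp d"] by auto
    have "rot d \<in> D - A" if "d \<in> D - A" "vert d \<noteq> c" for d using A(3) that rot(1) by blast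
    from face_walk_returns[OF Diff_subset o this z] obtain w where
      w: "w \<in> D - A" "vert w = c" "(z, opp w) \<in> conn ?\<phi>" by blast
    then have "w \<in> {y, y'}" using Bc by blast
    then show ?thesis using w(3) by blast
  qed
  \<comment> \<open>The forced route is \<open>x\<close>, \<open>opp x'\<close>, \<open>y'\<close>,
    \<open>opp y\<close>, \<open>x'\<close>, \<open>opp x\<close>: an arrival at \<open>c\<close>
    through \<open>opp d\<close> is continued by \<open>rot d\<close>.\<close>
  have "(x, opp x') \<in> conn ?\<phi>" using wA two x(1) xc by blast
  then have "(x, y') \<in> conn ?\<phi>" using \<phi>[OF D(2)] unfolding y'_def by (rule conn_trans)
  moreover have "(y', opp y) \<in> conn ?\<phi>" using wB two D by blast
  then have "(y', x') \<in> conn ?\<phi>" using \<phi>[OF D(1)] unfolding x'_def by (rule conn_trans)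
  moreover have "(x', opp x) \<in> conn ?\<phi>" using wA two D by blast
  ultimately have "(x, opp x) \<in> conn ?\<phi>" by (blast intro: conn_trans)
  then show False using two x(1) xc by blast
qed

end

section \<open>Strands and components\<close>

context four_regular_map
begin

text \<open>Both maps are involutions on the darts: \<open>opp\<close> runs along an edge,
  \<open>rot \<circ> rot\<close> goes straight across a vertex. The classes are the threaded
  circuits without direction or starting point.\<close>

definition strands :: "('d \<times> 'd) set" where
  "strands = fgraph D opp \<union> fgraph D (rot \<circ> rot)"

lemma edge_of_eq:
  assumes "d \<in> D" "z \<in> edge_of opp d"
  shows "z \<in> D" "edge_of opp z = edge_of opp d"
  using assms opp by (auto simp: edge_of_def)

text \<open>The list applies the two involutions in turn and closes up, so its darts with their
  opposites form a set that is both invariant and connected.\<close>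

lemma threaded_circuit_class:
  assumes "threaded_circuit D opp rot ds" "d \<in> set ds"
  shows "conn strands `` {d} = \<Union>(edge_of opp ` set ds)" (is "_ = ?S")
proof
  let ?n = "length ds"
  have n: "?n > 0" and sub: "\<And>i. i < ?n \<Longrightarrow> ds ! i \<in> D"
    and next_dart: "\<And>i. i < ?n \<Longrightarrow> rot (rot (opp (ds ! i))) = ds ! (Suc i mod ?n)"
    using assms(1) by (auto simp: threaded_circuit_def thread_def)
  have S: "z \<in> ?S \<longleftrightarrow> (\<exists>i<?n. z = ds ! i \<or> z = opp (ds ! i))" for z
  proof -
    have "z \<in> ?S \<longleftrightarrow> (\<exists>e\<in>set ds. z = e \<or> z = opp e)" by (simp add: edge_of_def)
    then show ?thesis unfolding in_set_conv_nth Bex_def by metis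
  qed
  have opp_S: "opp z \<in> ?S" if "z \<in> ?S" for z
    using that opp(2) sub unfolding S by metis
  have rot_S: "rot (rot z) \<in> ?S" if "z \<in> ?S" for z
  proof -
    from that obtain i where i: "i < ?n" "z = ds ! i \<or> z = opp (ds ! i)" unfolding S by blast
    show ?thesis
    proof (cases "z = ds ! i")
      case True
      \<comment> \<open>\<open>j\<close> is the cyclic predecessor of \<open>i\<close>; crossing the
        vertex backwards from \<open>ds ! i\<close> ends at \<open>opp (ds ! j)\<close>.\<close>
      define j where "j = (if i = 0 then ?n - 1 else i - 1)"
      have j: "j < ?n" "Suc j mod ?n = i" using i(1) n by (auto simp: j_def)
      then have "z = rot (rot (opp (ds ! j)))" using next_dart True by simp
      then have "rot (rot z) = opp (ds ! j)" using rot2(2) opp(1) sub j(1) by simp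
      then show ?thesis using j(1) unfolding S by blast
    next
      case False
      then have "rot (rot z) = ds ! (Suc i mod ?n)" using i next_dart by simp
      then show ?thesis using n mod_less_divisor unfolding S by blast
    qed
  qed
  have closed: "u \<in> ?S \<longleftrightarrow> v \<in> ?S" if "(u, v) \<in> strands" for u v
  proof -
    have "u \<in> D" "v = opp u \<or> v = rot (rot u)" using that by (auto simp: strands_def fgraph_def)
    then show ?thesis using opp_S rot_S opp(2) rot2(2) by metis
  qed
  have "d \<in> ?S" using assms(2) by (auto simp: edge_of_def)
  then show "conn strands `` {d} \<subseteq> ?S" using conn_closed[of d _ strands ?S] closed by blast
  have st: "(z, opp z) \<in> conn strands" "(z, rot (rot z)) \<in> conn strands" if "z \<in> D" for z
    using that by (auto simp: strands_def fgraph_def intro!: conn_base)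
  have from0: "(ds ! 0, ds ! i) \<in> conn strands" if "i < ?n" for i
    using that
  proof (induction i)
    case (Suc i)
    then have i: "i < ?n" by simp
    have "(ds ! i, opp (ds ! i)) \<in> conn strands" using st sub i by blast
    moreover have "(opp (ds ! i), ds ! Suc i) \<in> conn strands"
      using st(2)[OF opp(1)[OF sub[OF i]]] next_dart[OF i] Suc.prems by simp
    ultimately show ?case using Suc.IH[OF i] conn_trans by metis
  qed simp
  have S0: "(ds ! 0, z) \<in> conn strands" if "z \<in> ?S" for z
    using that from0 st(1) sub conn_trans unfolding S by metis
  show "?S \<subseteq> conn strands `` {d}"
  proof
    fix z assume "z \<in> ?S"
    then show "z \<in> conn strands `` {d}"
      using S0[of z] S0[OF \<open>d \<in> ?S\<close>] conn_sym conn_trans by fast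
  qed
qed

text \<open>Each circuit is sent to its class of darts. Rotations and reversals of a list have the
  same class, but they share edges, so the partition holds only one of them; every class is reached
  because every edge is covered.\<close>

lemma card_threaded_circuit_partition:
  assumes "threaded_circuit_partition D opp rot C"
  shows "card C = card (classes D strands)"
proof -
  let ?X = "\<lambda>ds. \<Union>(edge_of opp ` set ds)"
  have circ: "threaded_circuit D opp rot ds" if "ds \<in> C" for ds
    using assms that by (simp add: threaded_circuit_partition_def)
  have uniq: "\<exists>!ds. ds \<in> C \<and> edge_of opp d \<in> edge_of opp ` set ds" if "d \<in> D" for d
    using assms that by (simp add: threaded_circuit_partition_def)
  have "bij_betw ?X C (classes D strands)"
    unfolding bij_betw_def
  proof
    show "inj_on ?X C"
    proof (rule inj_onI)
      fix ds ds' assume C: "ds \<in> C" "ds' \<in> C" and eq: "?X ds = ?X ds'"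
      have ds: "ds \<noteq> []" "set ds \<subseteq> D" "set ds' \<subseteq> D"
        using circ C by (auto simp: threaded_circuit_def)
      let ?d = "hd ds"
      have "?d \<in> set ds" "?d \<in> D" using ds by auto
      then have "?d \<in> ?X ds'" unfolding eq[symmetric] by (auto simp: edge_of_def)
      then obtain e where "e \<in> set ds'" "?d \<in> edge_of opp e" by blast
      then have "edge_of opp ?d \<in> edge_of opp ` set ds'" using edge_of_eq(2) ds(3) by blast
      with \<open>?d \<in> set ds\<close> C show "ds = ds'" using uniq[OF \<open>?d \<in> D\<close>] by blast
    qed
    show "?X ` C = classes D strands"
    proof (intro set_eqI iffI)
      fix Y assume "Y \<in> ?X ` C"
      then obtain ds where ds: "ds \<in> C" "Y = ?X ds" by blast
      then have "hd ds \<in> set ds" "hd ds \<in> D" using circ[of ds] by (auto simp: threaded_circuit_def)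
      then have "conn strands `` {hd ds} = Y" using threaded_circuit_class circ ds by blast
      then show "Y \<in> classes D strands" using \<open>hd ds \<in> D\<close> by (auto simp: classes_def)
    next
      fix Y assume "Y \<in> classes D strands"
      then obtain d where d: "d \<in> D" "Y = conn strands `` {d}" by (auto simp: classes_def)
      obtain ds where ds: "ds \<in> C" "edge_of opp d \<in> edge_of opp ` set ds" using uniq[OF d(1)] by blast
      then obtain e where e: "e \<in> set ds" "edge_of opp d = edge_of opp e" by blast
      have X: "conn strands `` {e} = ?X ds" using threaded_circuit_class circ ds(1) e(1) by blast
      have "d \<in> ?X ds" using e by (auto simp: edge_of_def)
      then have "(e, d) \<in> conn strands" unfolding X[symmetric] by blast
      then have "conn strands `` {e} = conn strands `` {d}" by (simp add: class_eq_iff)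
      then show "Y \<in> ?X ` C" using X d(2) ds(1) by auto
    qed
  qed
  then show ?thesis by (rule bij_betw_same_card)
qed

section \<open>Components of the graph without \<open>c\<close>\<close>

definition linked_off :: "'v \<Rightarrow> ('v \<times> 'v) set" where
  "linked_off c = (adj (del_vertex_darts D opp vert c) opp vert)\<^sup>*"

lemma adj_offE:
  assumes "(u, w) \<in> adj (del_vertex_darts D opp vert c) opp vert"
  obtains e where "e \<in> D" "vert e = u" "vert (opp e) = w" "u \<noteq> c" "w \<noteq> c"
  using assms by (auto simp: adj_def del_vertex_darts_def)

lemma linked_off_dart:
  "d \<in> D \<Longrightarrow> vert d \<noteq> c \<Longrightarrow> vert (opp d) \<noteq> c \<Longrightarrow> (vert d, vert (opp d)) \<in> linked_off c"
  unfolding linked_off_def by (rule r_into_rtrancl) (auto simp: adj_def del_vertex_darts_def)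

lemma linked_off_sym: "(u, w) \<in> linked_off c \<Longrightarrow> (w, u) \<in> linked_off c"
proof -
  have "sym (adj (del_vertex_darts D opp vert c) opp vert)"
  proof (rule symI)
    fix u w assume "(u, w) \<in> adj (del_vertex_darts D opp vert c) opp vert"
    then obtain e where "e \<in> D" "vert e = u" "vert (opp e) = w" "u \<noteq> c" "w \<noteq> c" by (rule adj_offE)
    then show "(w, u) \<in> adj (del_vertex_darts D opp vert c) opp vert"
      using opp(1,2)[of e] unfolding adj_def del_vertex_darts_def by force
  qed
  then show "(u, w) \<in> linked_off c \<Longrightarrow> (w, u) \<in> linked_off c"
    unfolding linked_off_def by (meson symD sym_rtrancl)
qed

lemma linked_off_trans: "(u, v) \<in> linked_off c \<Longrightarrow> (v, w) \<in> linked_off c \<Longrightarrow> (u, w) \<in> linked_off c"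
  unfolding linked_off_def by (rule rtrancl_trans)

text \<open>A path that avoids \<open>c\<close> never uses the edge of \<open>d\<close>, which has
  an end at \<open>c\<close>. So each vertex keeps its link to \<open>c\<close> through a dart
  \<open>w\<close> of another edge.\<close>

lemma nonbridge_if_doubly_attached:
  assumes d: "d \<in> D" "vert d = c"
    and attached: "\<And>z. z \<in> D \<Longrightarrow> vert z \<noteq> c \<Longrightarrow>
      \<exists>w\<in>D. vert w = c \<and> w \<noteq> d \<and> w \<noteq> opp d \<and> (vert z, vert (opp w)) \<in> linked_off c"
    and "x \<in> D" "y \<in> D"
  shows "(x, y) \<in> conn (edges_except d)"
proof -
  let ?R = "conn (edges_except d)"
  have rotR: "(x, y) \<in> ?R" if "x \<in> D" "y \<in> D" "vert x = vert y" for x y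
    using that conn_rot_iff[of x y] conn_mono[of "fgraph D rot" "edges_except d"]
    by (auto simp: edges_except_def)
  have oppR: "(w, opp w) \<in> ?R" if "w \<in> D" "w \<noteq> d" "w \<noteq> opp d" for w
    using that by (auto simp: edges_except_def fgraph_def intro!: conn_base)
  have linkR: "\<forall>x\<in>D. \<forall>y\<in>D. vert x = p \<longrightarrow> vert y = q \<longrightarrow> (x, y) \<in> ?R" if "(p, q) \<in> linked_off c" for p q
    using that unfolding linked_off_def
  proof (induction rule: rtrancl_induct)
    case base
    then show ?case using rotR by auto
  next
    case (step q r)
    from step.hyps(2) obtain e where e: "e \<in> D" "vert e = q" "vert (opp e) = r" "q \<noteq> c" "r \<noteq> c"
      by (rule adj_offE)
    then have "(e, opp e) \<in> ?R" using oppR d opp by metis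
    then show ?case using step.IH e opp(1) rotR conn_trans by metis
  qed
  have "(z, d) \<in> ?R" if z: "z \<in> D" for z
  proof (cases "vert z = c")
    case True
    then show ?thesis using rotR d z by simp
  next
    case False
    then obtain w where w: "w \<in> D" "vert w = c" "w \<noteq> d" "w \<noteq> opp d" "(vert z, vert (opp w)) \<in> linked_off c"
      using attached z by blast
    then have "(z, opp w) \<in> ?R" using linkR[OF w(5)] z opp(1)[OF w(1)] by simp
    moreover have "(opp w, w) \<in> ?R" by (rule conn_sym[OF oppR[OF w(1,3,4)]])
    moreover have "(w, d) \<in> ?R" using rotR w d by simp
    ultimately show ?thesis using conn_trans by metis
  qed
  from this[OF assms(4)] this[OF assms(5)] show ?thesis by (blast intro: conn_sym conn_trans)
qed

definition attach :: "'v \<Rightarrow> 'v set \<Rightarrow> 'd set" where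
  "attach c K = {d \<in> D. vert d = c \<and> vert (opp d) \<in> K}"

text \<open>Darts at vertices of \<open>K\<close> are paired by \<open>rot \<circ> rot\<close>;
  those whose edge stays in \<open>K\<close> are also paired by \<open>opp\<close>. What remains is
  opposite to the darts at \<open>c\<close> that lead into \<open>K\<close>.\<close>

lemma even_card_attach:
  assumes K: "c \<notin> K" "\<And>d. d \<in> D \<Longrightarrow> vert d \<in> K \<Longrightarrow> vert (opp d) \<in> insert c K"
  shows "even (card (attach c K))"
proof -
  let ?Z = "{d \<in> D. vert d \<in> K}"
  let ?X = "{d \<in> ?Z. vert (opp d) \<noteq> c}"
  have Z: "even (card ?Z)"
    by (rule even_card_involution[where f = "rot \<circ> rot"]) (use finD rot rot2 in auto)
  have X: "even (card ?X)"
  proof (rule even_card_involution[where f = opp])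
    fix d assume d: "d \<in> ?X"
    then have "vert (opp d) \<in> K" "vert d \<noteq> c" using K by auto
    then show "opp d \<in> ?X \<and> opp (opp d) = d \<and> opp d \<noteq> d" using d opp by simp
  qed (use finD in simp)
  have split: "?Z = ?X \<union> opp ` attach c K"
  proof (intro set_eqI iffI)
    fix d assume d: "d \<in> ?Z"
    show "d \<in> ?X \<union> opp ` attach c K"
    proof (cases "vert (opp d) = c")
      case True
      then have "opp d \<in> attach c K" "d = opp (opp d)" using d opp by (auto simp: attach_def)
      then show ?thesis by blast
    qed (use d in simp)
  qed (use opp in \<open>auto simp: attach_def\<close>)
  have disj: "?X \<inter> opp ` attach c K = {}" using opp by (auto simp: attach_def)
  have fin: "finite ?X" "finite (opp ` attach c K)" using finD by (simp_all add: attach_def)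
  have "card ?Z = card ?X + card (opp ` attach c K)"
    using card_Un_disjoint[OF fin disj] by (simp only: split[symmetric])
  moreover have "inj_on opp (attach c K)"
    by (rule inj_onI) (metis (no_types, lifting) attach_def mem_Collect_eq opp(2))
  ultimately show ?thesis using Z X by (simp add: card_image)
qed

lemma component_iff:
  "K \<in> components (V - {c}) (del_vertex_darts D opp vert c) opp vert \<longleftrightarrow>
     (\<exists>u\<in>V - {c}. K = {w \<in> V - {c}. (u, w) \<in> linked_off c})"
  by (auto simp: components_def linked_off_def)

context
  fixes c K
  assumes K: "K \<in> components (V - {c}) (del_vertex_darts D opp vert c) opp vert"
begin

lemma component_linked: "u \<in> K \<Longrightarrow> w \<in> K \<Longrightarrow> (u, w) \<in> linked_off c"
  using K linked_off_sym linked_off_trans unfolding component_iff by blast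

lemma component_sub: "K \<subseteq> V - {c}"
  using K unfolding component_iff by blast

lemma component_opp: "d \<in> D \<Longrightarrow> vert d \<in> K \<Longrightarrow> vert (opp d) \<in> insert c K"
proof -
  assume d: "d \<in> D" "vert d \<in> K"
  then have "vert d \<noteq> c" using component_sub by auto
  obtain u where u: "K = {w \<in> V - {c}. (u, w) \<in> linked_off c}" using K unfolding component_iff by blast
  show ?thesis
    using linked_off_dart[OF d(1) \<open>vert d \<noteq> c\<close>] d vert[OF opp(1)[OF d(1)]] linked_off_trans[of u "vert d" c]
    unfolding u by auto
qed

text \<open>Connectedness provides one dart from \<open>c\<close> into the component, and parity a
  second.\<close>

lemma card_attach_ge2:
  assumes "connected_graph V D opp vert" "c \<in> V"
  shows "2 \<le> card (attach c K)"
proof -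
  obtain u where u: "u \<in> K" using K unfolding component_iff linked_off_def by auto
  have "attach c K \<noteq> {}"
  proof
    assume none: "attach c K = {}"
    have "(u, c) \<in> (adj D opp vert)\<^sup>*"
      using assms u component_sub by (auto simp: connected_graph_def)
    then have "c \<in> K"
    proof (induction rule: rtrancl_induct)
      case (step v w)
      then obtain d where d: "d \<in> D" "vert d \<in> K" "w = vert (opp d)" by (auto simp: adj_def)
      then have "opp d \<notin> attach c K" using none by simp
      then have "w \<noteq> c" using d opp by (auto simp: attach_def)
      then show ?case using component_opp d by auto
    qed (use u in simp)
    then show False using component_sub by auto
  qed
  then have "card (attach c K) \<noteq> 0" using finD by (simp add: attach_def)
  moreover have "even (card (attach c K))"
    using even_card_attach component_sub component_opp by blast
  ultimately show ?thesis by (metis One_nat_def Suc_1 Suc_leI le_neq_implies_less neq0_conv odd_one)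
qed

end

text \<open>Each component takes at least two of the four darts at \<open>c\<close>, so there are
  exactly two components with two darts each, and no dart remains for a loop at
  \<open>c\<close>.\<close>

lemma cut_vertex_components:
  assumes conn: "connected_graph V D opp vert" and c: "c \<in> V"
    and cut: "\<not> connected_graph (V - {c}) (del_vertex_darts D opp vert c) opp vert"
    and K1: "K1 \<in> components (V - {c}) (del_vertex_darts D opp vert c) opp vert"
    and K2: "K2 = V - {c} - K1"
  shows "K2 \<in> components (V - {c}) (del_vertex_darts D opp vert c) opp vert"
    and "card (attach c K1) = 2" "card (attach c K2) = 2"
    and "{d \<in> D. vert d = c} = attach c K1 \<union> attach c K2"
proof -
  let ?comp = "\<lambda>v. {w \<in> V - {c}. (v, w) \<in> linked_off c}"
  let ?A = "\<lambda>v. attach c (?comp v)"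
  let ?Dc = "{d \<in> D. vert d = c}"
  have two: "2 \<le> card (?A v)" if "v \<in> V - {c}" for v
    using card_attach_ge2[OF _ conn c, of "?comp v"] that by (auto simp: component_iff)
  have fin: "finite ?Dc" "\<And>v. finite (?A v)" using finD by (simp_all add: attach_def)
  have four: "card ?Dc = 4" using reg c by (simp add: four_regular_def)
  have sub: "?A v \<subseteq> ?Dc" for v by (auto simp: attach_def)
  have disj: "?A v \<inter> ?A w = {}" if "(v, w) \<notin> linked_off c" for v w
  proof (rule ccontr)
    assume "?A v \<inter> ?A w \<noteq> {}"
    then obtain d where "(v, vert (opp d)) \<in> linked_off c" "(w, vert (opp d)) \<in> linked_off c"
      by (auto simp: attach_def)
    then show False using that linked_off_sym linked_off_trans by blast
  qed
  obtain u where u: "u \<in> V - {c}" "K1 = ?comp u" using K1 unfolding component_iff by blast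
  obtain v where v: "v \<in> K2"
  proof -
    obtain p q where pq: "p \<in> V - {c}" "q \<in> V - {c}" "(p, q) \<notin> linked_off c"
      using cut by (auto simp: connected_graph_def linked_off_def)
    then have "p \<notin> K1 \<or> q \<notin> K1" using component_linked[OF K1] by blast
    then show ?thesis using that pq K2 by blast
  qed
  have v': "v \<in> V - {c}" "(u, v) \<notin> linked_off c" using v K2 u by auto
  have one: "(v, w) \<in> linked_off c" if w: "w \<in> K2" for w
  proof (rule ccontr)
    assume vw: "(v, w) \<notin> linked_off c"
    have w': "w \<in> V - {c}" "(u, w) \<notin> linked_off c" using w K2 u by auto
    have "card (?A u \<union> ?A v \<union> ?A w) = card (?A u) + card (?A v) + card (?A w)"
      using fin disj[OF v'(2)] disj[OF w'(2)] disj[OF vw]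
      by (simp add: card_Un_disjoint Int_Un_distrib2)
    moreover have "card (?A u \<union> ?A v \<union> ?A w) \<le> 4"
      unfolding four[symmetric] by (intro card_mono fin(1) Un_least sub)
    ultimately show False using two[OF u(1)] two[OF v'(1)] two[OF w'(1)] by linarith
  qed
  have "K2 = ?comp v"
  proof (intro set_eqI iffI)
    fix w assume "w \<in> K2"
    then show "w \<in> ?comp v" using one K2 by simp
  next
    fix w assume w: "w \<in> ?comp v"
    then have "(u, w) \<notin> linked_off c" using v'(2) linked_off_sym linked_off_trans by blast
    then show "w \<in> K2" using w K2 u(2) by simp
  qed
  then show "K2 \<in> components (V - {c}) (del_vertex_darts D opp vert c) opp vert"
    using v'(1) unfolding component_iff by blast
  have "card (?A u \<union> ?A v) = card (?A u) + card (?A v)"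
    using fin disj[OF v'(2)] by (simp add: card_Un_disjoint)
  moreover have "?A u \<union> ?A v \<subseteq> ?Dc" using sub by blast
  moreover from card_mono[OF fin(1) this] have "card (?A u \<union> ?A v) \<le> 4" unfolding four .
  moreover note two[OF u(1)] two[OF v'(1)]
  ultimately have *: "card (?A u) = 2" "card (?A v) = 2" "card (?A u \<union> ?A v) = card ?Dc"
    unfolding four by linarith+
  have "?A u \<union> ?A v = ?Dc" by (intro card_subset_eq fin(1) Un_least sub *(3))
  note * = *(1,2) this
  then show "card (attach c K1) = 2" "card (attach c K2) = 2" "?Dc = attach c K1 \<union> attach c K2"
    using * unfolding u(2) \<open>K2 = ?comp v\<close> by simp_all
qed

end

section \<open>Splitting at a cut vertex\<close>

context four_regular_map
begin

text \<open>The strands with both threads at \<open>c\<close> severed. This relation is shared by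
  the whole map and by each side, which makes the three counts comparable.\<close>

definition strands_off :: "'v \<Rightarrow> ('d \<times> 'd) set" where
  "strands_off c = fgraph D opp \<union> fgraph {d \<in> D. vert d \<noteq> c} (rot \<circ> rot)"

lemma strands_off_iff:
  "(u, v) \<in> strands_off c \<longleftrightarrow> u \<in> D \<and> (v = opp u \<or> vert u \<noteq> c \<and> v = rot (rot u))"
  by (auto simp: strands_off_def fgraph_def)

lemma strands_iff: "(u, v) \<in> strands \<longleftrightarrow> u \<in> D \<and> (v = opp u \<or> v = rot (rot u))"
  by (auto simp: strands_def fgraph_def)

end

section \<open>One side of the cut vertex and its added loop\<close>

locale doubly_attached_component = four_regular_map V D opp vert rot
  for V :: "'v set" and D :: "'d set" and opp :: "'d \<Rightarrow> 'd" and vert :: "'d \<Rightarrow> 'v"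
    and rot :: "'d \<Rightarrow> 'd" +
  fixes c :: 'v and K :: "'v set" and a a' :: 'd
  assumes comp: "K \<in> components (V - {c}) (del_vertex_darts D opp vert c) opp vert"
    and attach: "attach c K = {a, a'}" and ne: "a \<noteq> a'"
    and loopfree: "\<And>d. d \<in> D \<Longrightarrow> vert d = c \<Longrightarrow> vert (opp d) \<noteq> c"
begin

definition DK :: "'d set" where
  "DK = induced_darts D opp vert (K \<union> {c})"

lemma c_notin: "c \<notin> K"
  using component_sub[OF comp] by auto

lemma DK_iff: "d \<in> DK \<longleftrightarrow> d \<in> D \<and> (vert d \<in> K \<or> d \<in> {a, a'})"
proof -
  have "vert (opp d) \<in> insert c K" if "d \<in> D" "vert d \<in> K"
    using component_opp[OF comp that] .
  moreover have "d \<in> {a, a'} \<longleftrightarrow> d \<in> D \<and> vert d = c \<and> vert (opp d) \<in> K"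
    unfolding attach[symmetric] by (simp add: attach_def)
  ultimately show ?thesis using loopfree[of d] by (auto simp: DK_def induced_darts_def)
qed

lemma a_facts: "a \<in> D" "a' \<in> D" "vert a = c" "vert a' = c" "vert (opp a) \<in> K" "vert (opp a') \<in> K"
proof -
  have "a \<in> attach c K" "a' \<in> attach c K" by (simp_all add: attach)
  then show "a \<in> D" "a' \<in> D" "vert a = c" "vert a' = c" "vert (opp a) \<in> K" "vert (opp a') \<in> K"
    by (simp_all add: attach_def)
qed

lemma DK_sub: "DK \<subseteq> D"
  by (auto simp: DK_def induced_darts_def)

lemma DK_opp: "d \<in> DK \<Longrightarrow> opp d \<in> DK"
  using opp by (auto simp: DK_def induced_darts_def)

lemma DK_at_c_eq: "{d \<in> DK. vert d = c} = {a, a'}"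
  using a_facts c_notin unfolding DK_iff by blast

lemma DK_at_c: "d \<in> DK \<Longrightarrow> vert d = c \<Longrightarrow> d \<in> {a, a'}"
  using DK_at_c_eq by blast

lemma DK_rot: "d \<in> D \<Longrightarrow> vert d \<noteq> c \<Longrightarrow> rot d \<in> DK \<longleftrightarrow> d \<in> DK"
  using rot[of d] a_facts by (auto simp: DK_iff)

lemma DK_strands_off: "(u, v) \<in> strands_off c \<Longrightarrow> u \<in> DK \<longleftrightarrow> v \<in> DK"
  using DK_opp[of u] DK_opp[of "opp u"] opp[of u] DK_rot[of u] DK_rot[of "rot u"] rot[of u]
  by (auto simp: strands_off_iff)

text \<open>Away from \<open>c\<close>, the darts of a strand are paired by both involutions; by parity, a strand that
  leaves \<open>c\<close> along \<open>a\<close> must come back along \<open>a'\<close>.\<close>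

lemma strand_returns: "(a, a') \<in> conn (strands_off c)"
proof (rule ccontr)
  assume no: "(a, a') \<notin> conn (strands_off c)"
  let ?X = "conn (strands_off c) `` {a}"
  let ?Y = "{d \<in> ?X. vert d \<noteq> c}"
  have "a \<in> DK" using a_facts by (simp add: DK_iff)
  have X: "?X \<subseteq> DK"
  proof
    fix d assume "d \<in> ?X"
    then have "(a, d) \<in> conn (strands_off c)" by simp
    then show "d \<in> DK" by (rule conn_closed[OF _ \<open>a \<in> DK\<close> DK_strands_off])
  qed
  then have D: "d \<in> D" if "d \<in> ?X" for d using DK_sub that by blast
  have fin: "finite ?X" using X DK_sub finD by (meson finite_subset)
  have step: "v \<in> ?X" if "u \<in> ?X" "(u, v) \<in> strands_off c" for u v
    using that by (auto intro: conn_trans conn_base)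
  have "even (card ?X)"
  proof (rule even_card_involution[where f = opp, OF fin])
    fix d assume d: "d \<in> ?X"
    then have "opp d \<in> ?X" using step[of d "opp d"] D by (simp only: strands_off_iff) blast
    then show "opp d \<in> ?X \<and> opp (opp d) = d \<and> opp d \<noteq> d" using opp[OF D[OF d]] by simp
  qed
  moreover have "even (card ?Y)"
  proof (rule even_card_involution[where f = "rot \<circ> rot"])
    fix d assume d: "d \<in> ?Y"
    then have dD: "d \<in> D" "vert d \<noteq> c" "d \<in> ?X" using D by auto
    have "rot (rot d) \<in> ?X" using step[of d "rot (rot d)"] dD by (simp only: strands_off_iff) blast
    then show "(rot \<circ> rot) d \<in> ?Y \<and> (rot \<circ> rot) ((rot \<circ> rot) d) = d \<and> (rot \<circ> rot) d \<noteq> d"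
      using dD rot[of d] rot[of "rot d"] rot2[of d] by simp
  next
    show "finite ?Y" by (rule finite_subset[OF _ fin]) auto
  qed
  moreover have "?X = insert a ?Y"
  proof (intro set_eqI iffI)
    fix d assume d: "d \<in> ?X"
    show "d \<in> insert a ?Y"
    proof (cases "vert d = c")
      case True
      have "d \<in> DK" using d X by blast
      then have "d \<in> {a, a'}" using True by (rule DK_at_c)
      moreover have "d \<noteq> a'" using d no by auto
      ultimately show ?thesis by simp
    qed (use d in simp)
  qed auto
  moreover have "a \<notin> ?Y" using a_facts by simp
  moreover have "finite ?Y" by (rule finite_subset[OF _ fin]) auto
  ultimately show False by (metis card_insert_disjoint even_Suc)
qed

text \<open>A walk that avoids \<open>c\<close> cannot leave \<open>K\<close>, so all its edges
  survive in the looped side.\<close>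

lemma linked_DK:
  assumes "(u, w) \<in> linked_off c" "u \<in> K"
  shows "(u, w) \<in> (adj (del_vertex_darts (add_loop_darts DK) (add_loop_opp opp) (add_loop_vert vert c) c)
      (add_loop_opp opp) (add_loop_vert vert c))\<^sup>* \<and> w \<in> K"
  using assms(1) unfolding linked_off_def
proof (induction rule: rtrancl_induct)
  case (step v w)
  from step.hyps(2) obtain e where e: "e \<in> D" "vert e = v" "vert (opp e) = w" "v \<noteq> c" "w \<noteq> c"
    by (rule adj_offE)
  have v: "v \<in> K" using step.IH by simp
  then have w: "w \<in> K" using component_opp[OF comp e(1)] e by auto
  let ?D' = "del_vertex_darts (add_loop_darts DK) (add_loop_opp opp) (add_loop_vert vert c) c"
  have "Inl e \<in> ?D'"
    using e v by (simp add: del_vertex_darts_def add_loop_darts_def add_loop_opp_def add_loop_vert_def DK_iff)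
  moreover have "v = add_loop_vert vert c (Inl e)" "w = add_loop_vert vert c (add_loop_opp opp (Inl e))"
    using e by (simp_all add: add_loop_opp_def add_loop_vert_def)
  ultimately have "(v, w) \<in> adj ?D' (add_loop_opp opp) (add_loop_vert vert c)"
    unfolding adj_def by blast
  then show ?case using step.IH w by (meson rtrancl.rtrancl_into_rtrancl)
qed (use assms(2) in simp)

text \<open>In the looped side, the threads at \<open>c\<close> lead from \<open>a\<close> and
  \<open>a'\<close> to the two ends of the loop. The loop only closes a strand whose ends
  \<open>a\<close> and \<open>a'\<close> are already connected off \<open>c\<close>, so collapsing
  it leaves the number of classes unchanged.\<close>

lemma card_side_partition:
  assumes plane': "plane_map (K \<union> {c}) (add_loop_darts DK) (add_loop_opp opp) (add_loop_vert vert c) rot'"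
    and ext: "extends_induced rot DK rot'"
    and tcp': "threaded_circuit_partition (add_loop_darts DK) (add_loop_opp opp) rot' C'"
  shows "card C' = card (classes DK (strands_off c))"
proof -
  let ?D' = "add_loop_darts DK" and ?opp' = "add_loop_opp opp" and ?vert' = "add_loop_vert vert c"
  have simps': "?opp' (Inl d) = Inl (opp d)" "?opp' (Inr b) = Inr (\<not> b)"
    "?vert' (Inl d) = vert d" "?vert' (Inr b) = c" "Inl d \<in> ?D' \<longleftrightarrow> d \<in> DK" "Inr b \<in> ?D'" for d b
    by (auto simp: add_loop_opp_def add_loop_vert_def add_loop_darts_def)
  have D'E: "(\<exists>d\<in>DK. z = Inl d) \<or> (\<exists>b. z = Inr b)" if "z \<in> ?D'" for z
    using that by (auto simp: add_loop_darts_def)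
  have at_c: "{z \<in> ?D'. ?vert' z = c} = {Inl a, Inl a', Inr False, Inr True}"
  proof -
    have "{z \<in> ?D'. ?vert' z = c} = Inl ` {d \<in> DK. vert d = c} \<union> {Inr False, Inr True}"
      by (auto simp: add_loop_darts_def add_loop_vert_def)
    then show ?thesis unfolding DK_at_c_eq by auto
  qed
  have reg': "four_regular (K \<union> {c}) ?D' ?vert'"
    unfolding four_regular_def
  proof
    fix v assume v: "v \<in> K \<union> {c}"
    show "card {z \<in> ?D'. ?vert' z = v} = 4"
    proof (cases "v = c")
      case True
      then show ?thesis using at_c ne by simp
    next
      case False
      then have "v \<in> K" "v \<in> V" using v component_sub[OF comp] by auto
      then have "{z \<in> ?D'. ?vert' z = v} = Inl ` {d \<in> D. vert d = v}"
        using False by (auto simp: simps' DK_iff a_facts dest!: D'E)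
      then show ?thesis using reg \<open>v \<in> V\<close> by (simp add: card_image four_regular_def)
    qed
  qed
  interpret G': four_regular_map "K \<union> {c}" ?D' ?opp' ?vert' rot'
    using plane' reg' by unfold_locales (auto simp: plane_map_def)
  \<comment> \<open>All darts at a vertex of \<open>K\<close> belong to this side, so there the
    induced rotation stops after one step and \<open>rot'\<close> agrees with \<open>rot\<close>. At
    \<open>c\<close> the place of the loop stays open.\<close>
  have rot'_Inl: "rot' (Inl d) = Inl (rot d)" if d: "d \<in> DK" "vert d \<noteq> c" for d
  proof -
    have one: "(LEAST n. 0 < n \<and> (f ^^ n) x \<in> S) = 1" if "f x \<in> S" for f :: "'x \<Rightarrow> 'x" and x S
      using that by (intro Least_equality) auto
    have "rot d \<in> DK" using d DK_rot DK_sub by blast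
    moreover have "rot' (Inl d) \<in> Inl ` DK"
    proof -
      have "Inl d \<in> ?D'" using d by (simp add: simps')
      then have "rot' (Inl d) \<in> ?D'" "?vert' (rot' (Inl d)) \<noteq> c"
        using G'.rot[of "Inl d"] d by (simp_all add: simps')
      then show ?thesis using D'E[of "rot' (Inl d)"] by (auto simp: simps')
    qed
    moreover have "induced_rot rot' (Inl ` DK) (Inl d) = Inl (induced_rot rot DK d)"
      using ext d by (simp add: extends_induced_def)
    ultimately show ?thesis by (simp add: induced_rot_def one)
  qed
  have nonbridge: "(x, y) \<in> conn (G'.edges_except e)"
    if e: "e \<in> ?D'" "?vert' e = c" and xy: "x \<in> ?D'" "y \<in> ?D'" for e x y
  proof (rule G'.nonbridge_if_doubly_attached[OF e _ xy])
    fix z assume z: "z \<in> ?D'" "?vert' z \<noteq> c"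
    then obtain d where d: "d \<in> DK" "z = Inl d" using D'E[of z] by (auto simp: simps')
    then have dK: "vert d \<in> K" using z a_facts by (auto simp: DK_iff simps')
    \<comment> \<open>An attaching dart other than \<open>e\<close>; if \<open>e\<close> is a loop
      dart, the default \<open>a\<close> differs from both ends of the loop.\<close>
    define w where "w = (if e = Inl a then a' else a)"
    have w: "w \<in> {a, a'}" "Inl w \<noteq> e" using ne by (auto simp: w_def)
    have "Inl w \<noteq> ?opp' e"
    proof
      assume "Inl w = ?opp' e"
      then obtain d where "e = Inl d" "w = opp d" by (cases e) (auto simp: simps')
      moreover from this have "d \<in> D" "vert d = c" using e DK_sub by (auto simp: simps')
      ultimately show False using loopfree w(1) a_facts by auto
    qed
    moreover have "(vert d, vert (opp w)) \<in> linked_off c"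
      using component_linked[OF comp dK] w(1) a_facts by auto
    then have "(?vert' z, ?vert' (?opp' (Inl w))) \<in> G'.linked_off c"
      using linked_DK dK d(2) by (simp add: G'.linked_off_def simps')
    moreover have "Inl w \<in> ?D'" "?vert' (Inl w) = c" using w(1) a_facts by (auto simp: simps' DK_iff)
    ultimately show "\<exists>w\<in>?D'. ?vert' w = c \<and> w \<noteq> e \<and> w \<noteq> ?opp' e \<and> (?vert' z, ?vert' (?opp' w)) \<in> G'.linked_off c"
      using w(2) by blast
  qed
  have aD': "Inl a \<in> ?D'" using a_facts by (simp add: simps' DK_iff)
  \<comment> \<open>If \<open>a\<close> and \<open>a'\<close> were opposite at \<open>c\<close>,
    they would alternate with the loop ends; so the thread of \<open>a\<close> must end at some loop
    dart \<open>b0\<close>.\<close>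
  have "rot' (rot' (Inl a)) \<noteq> Inl a'"
  proof
    assume eq: "rot' (rot' (Inl a)) = Inl a'"
    show False
    proof (rule G'.no_alternation[OF plane', of "Inl ` DK" c "Inl a"])
      show "Inl ` DK \<subseteq> ?D'" by (auto simp: simps')
      show "?opp' d \<in> Inl ` DK" if "d \<in> Inl ` DK" for d using that DK_opp by (auto simp: simps')
      show "rot' d \<in> Inl ` DK \<longleftrightarrow> d \<in> Inl ` DK" if d: "d \<in> ?D'" "?vert' d \<noteq> c" for d
      proof -
        obtain d0 where d0: "d0 \<in> DK" "d = Inl d0" using D'E[of d] d by (auto simp: simps')
        then have "vert d0 \<noteq> c" using d by (simp add: simps')
        moreover from this have "rot d0 \<in> DK" using d0 DK_rot DK_sub by blast
        ultimately show ?thesis using rot'_Inl[of d0] d0 by auto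
      qed
      have "{d \<in> Inl ` DK. ?vert' d = c} = Inl ` {d \<in> DK. vert d = c}"
        by (auto simp: add_loop_vert_def)
      then show "{d \<in> Inl ` DK. ?vert' d = c} = {Inl a, rot' (rot' (Inl a))}"
        unfolding eq DK_at_c_eq by simp
    qed (use aD' nonbridge in auto)
  qed
  moreover have "rot' (rot' (Inl a)) \<noteq> Inl a" using G'.rot2(1)[OF aD'] .
  moreover have "rot' (rot' (Inl a)) \<in> {z \<in> ?D'. ?vert' z = c}"
    using G'.rot[of "Inl a"] G'.rot[of "rot' (Inl a)"] aD' a_facts by (simp add: simps')
  ultimately obtain b0 where b0: "rot' (rot' (Inl a)) = Inr b0" unfolding at_c by auto
  \<comment> \<open>Both loop darts are collapsed to \<open>a\<close>; \<open>a'\<close> would serve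
    equally, since the two are connected off \<open>c\<close>.\<close>
  let ?p = "case_sum (\<lambda>d. d) (\<lambda>_. a)"
  have "card (classes ?D' G'.strands) = card (classes DK (strands_off c))"
  proof (rule card_classes_retract[where p = ?p and g = Inl])
    have "?p ` ?D' = insert a DK" by (simp add: add_loop_darts_def image_Un image_image)
    then show "?p ` ?D' = DK" using aD' by (simp add: simps' insert_absorb)
    show "u \<in> DK \<longleftrightarrow> v \<in> DK" if "(u, v) \<in> strands_off c" for u v using DK_strands_off that .
    show "(Inl u, Inl v) \<in> conn G'.strands" if "(u, v) \<in> strands_off c" "u \<in> DK" for u v
    proof (rule conn_base)
      show "(Inl u, Inl v) \<in> G'.strands"
      proof (cases "v = opp u")
        case True
        then show ?thesis using that by (simp add: G'.strands_iff simps')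
      next
        case False
        then have v: "vert u \<noteq> c" "v = rot (rot u)" using that by (auto simp: strands_off_iff)
        have uD: "u \<in> D" using that DK_sub by blast
        have "rot u \<in> DK" "vert (rot u) \<noteq> c" using v(1) uD that rot DK_rot by auto
        then have "Inl v = rot' (rot' (Inl u))" using rot'_Inl v that by simp
        then show ?thesis using that by (simp add: G'.strands_iff simps')
      qed
    qed
    show "(x, Inl (?p x)) \<in> conn G'.strands" if "x \<in> ?D'" for x
    proof (cases x)
      case (Inr b)
      have "(Inl a, Inr b0) \<in> conn G'.strands" using aD' b0 by (auto simp: G'.strands_iff intro!: conn_base)
      moreover have "(Inr b0, Inr (\<not> b0)) \<in> conn G'.strands"
        by (auto simp: G'.strands_iff simps' intro!: conn_base)
      ultimately have "(Inl a, Inr b) \<in> conn G'.strands"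
        by (cases "b = b0") (auto intro: conn_trans)
      then show ?thesis using Inr by (auto intro: conn_sym)
    qed simp
    \<comment> \<open>All four darts at \<open>c\<close> are sent to \<open>a\<close> or
      \<open>a'\<close>, so the returning strand absorbs every thread at \<open>c\<close>.\<close>
    have hub: "(x, y) \<in> conn (strands_off c)" if "x \<in> {a, a'}" "y \<in> {a, a'}" for x y
      using that strand_returns conn_sym by auto
    have p_at_c: "?p z \<in> {a, a'}" if "z \<in> ?D'" "?vert' z = c" for z
    proof -
      have "z \<in> {Inl a, Inl a', Inr False, Inr True}" unfolding at_c[symmetric] using that by simp
      then show ?thesis by auto
    qed
    show "(?p u, ?p v) \<in> conn (strands_off c)" if uv: "(u, v) \<in> G'.strands" for u v
    proof -
      have u: "u \<in> ?D'" "v = ?opp' u \<or> v = rot' (rot' u)" using uv by (auto simp: G'.strands_iff)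
      consider "v = ?opp' u" | "v = rot' (rot' u)" "?vert' u = c" | "v = rot' (rot' u)" "?vert' u \<noteq> c"
        using u(2) by blast
      then show ?thesis
      proof cases
        case 1
        then show ?thesis
          using u(1) DK_sub by (cases u) (auto simp: simps' strands_off_iff intro!: conn_base)
      next
        case 2
        then have "v \<in> ?D'" "?vert' v = c" using u(1) G'.rot by simp_all
        then show ?thesis using hub[OF p_at_c p_at_c] u(1) 2 by simp
      next
        case 3
        then obtain d where d: "d \<in> DK" "u = Inl d" using D'E[of u] u(1) by (auto simp: simps')
        then have dc: "d \<in> D" "vert d \<noteq> c" using 3 DK_sub by (auto simp: simps')
        then have "rot d \<in> DK" "vert (rot d) \<noteq> c" using d rot DK_rot by auto
        then have "v = Inl (rot (rot d))" using rot'_Inl 3 d dc by simp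
        then show ?thesis using d dc by (auto simp: strands_off_iff intro!: conn_base)
      qed
    qed
  qed
  then show ?thesis using G'.card_threaded_circuit_partition[OF tcp'] by simp
qed

end

section \<open>Fusing the two sides at \<open>c\<close>\<close>

theorem mainTheorem2:
  fixes V :: "'v set" and D :: "'d set" and opp rot :: "'d \<Rightarrow> 'd" and vert :: "'d \<Rightarrow> 'v"
    and c :: 'v and K1 K2 :: "'v set" and D1 D2 :: "'d set"
    and rot1 rot2 :: "'d + bool \<Rightarrow> 'd + bool"
    and C :: "'d list set" and C1 C2 :: "('d + bool) list set"
  assumes plane: "plane_map V D opp vert rot"
    and conn: "connected_graph V D opp vert"
    and reg: "four_regular V D vert"
    and c_in: "c \<in> V"
    and cut: "\<not> connected_graph (V - {c}) (del_vertex_darts D opp vert c) opp vert"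
    and K1: "K1 \<in> components (V - {c}) (del_vertex_darts D opp vert c) opp vert"
    and K2: "K2 = V - {c} - K1"
    and D1: "D1 = induced_darts D opp vert (K1 \<union> {c})"
    and D2: "D2 = induced_darts D opp vert (K2 \<union> {c})"
    and plane1: "plane_map (K1 \<union> {c}) (add_loop_darts D1) (add_loop_opp opp) (add_loop_vert vert c) rot1"
    and ext1: "extends_induced rot D1 rot1"
    and plane2: "plane_map (K2 \<union> {c}) (add_loop_darts D2) (add_loop_opp opp) (add_loop_vert vert c) rot2"
    and ext2: "extends_induced rot D2 rot2"
    and tcp: "threaded_circuit_partition D opp rot C"
    and tcp1: "threaded_circuit_partition (add_loop_darts D1) (add_loop_opp opp) rot1 C1"
    and tcp2: "threaded_circuit_partition (add_loop_darts D2) (add_loop_opp opp) rot2 C2"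
  shows "card C + 1 = card C1 + card C2"
proof -
  interpret four_regular_map V D opp vert rot
    using plane reg by unfold_locales (auto simp: plane_map_def)
  note comps = cut_vertex_components[OF conn c_in cut K1 K2]
  obtain a a' where a: "attach c K1 = {a, a'}" "a \<noteq> a'"
    using comps(2) by (auto simp: card_2_iff)
  have K12: "c \<notin> K1" "c \<notin> K2" using component_sub[OF K1] K2 by auto
  have loopfree: "vert (opp d) \<noteq> c" if "d \<in> D" "vert d = c" for d
  proof -
    have "d \<in> attach c K1 \<union> attach c K2" using that comps(4) by blast
    then show ?thesis using K12 by (auto simp: attach_def)
  qed
  interpret S1: doubly_attached_component V D opp vert rot c K1 a a'
    by unfold_locales (use K1 a loopfree in auto)
  note D1 = D1[folded S1.DK_def]
  have "rot (rot a) \<noteq> a'"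
  proof
    assume eq: "rot (rot a) = a'"
    show False
    proof (rule no_alternation[OF plane, of D1 c a])
      show "{d \<in> D1. vert d = c} = {a, rot (rot a)}"
        unfolding eq D1 by (rule S1.DK_at_c_eq)
      show "(x, y) \<in> conn (edges_except d)" if d: "d \<in> D" "vert d = c" and xy: "x \<in> D" "y \<in> D" for d x y
      proof (rule nonbridge_if_doubly_attached[OF d _ xy])
        fix z assume z: "z \<in> D" "vert z \<noteq> c"
        then obtain K where K: "K \<in> {K1, K2}" "vert z \<in> K" using K2 vert by blast
        \<comment> \<open>Of the two darts that lead into the component of \<open>z\<close>, at
          least one differs from \<open>d\<close>.\<close>
        have "card (attach c K) = 2" using comps(2,3) K(1) by auto
        then obtain w where w: "w \<in> attach c K" "w \<noteq> d" by (metis card_2_iff' )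
        then have w': "w \<in> D" "vert w = c" "vert (opp w) \<in> K" by (auto simp: attach_def)
        have "w \<noteq> opp d" using loopfree d w' by auto
        moreover have "(vert z, vert (opp w)) \<in> linked_off c"
          using component_linked[of K c] K1 comps(1) K w'(3) by blast
        ultimately show "\<exists>w\<in>D. vert w = c \<and> w \<noteq> d \<and> w \<noteq> opp d \<and> (vert z, vert (opp w)) \<in> linked_off c"
          using w(2) w' by blast
      qed
    qed (use S1.DK_sub S1.DK_opp S1.DK_rot S1.a_facts D1 in auto)
  qed
  \<comment> \<open>The thread partners of \<open>a\<close> and \<open>a'\<close>: as neither is
    \<open>a\<close> or \<open>a'\<close>, they must be the two darts into
    \<open>K2\<close>.\<close>
  define b b' where "b = rot (rot a)" and "b' = rot (rot a')"
  have aD: "a \<in> D" "a' \<in> D" "vert a = c" "vert a' = c" by (fact S1.a_facts)+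
  have bD: "b \<in> D" "b' \<in> D" "vert b = c" "vert b' = c" "rot (rot b) = a" "rot (rot b') = a'"
    using rot aD rot2(2) by (simp_all add: b_def b'_def)
  have "b \<noteq> b'" "b \<noteq> a" "b' \<noteq> a'" using bD(5,6) a(2) rot2(1) aD by (auto simp: b_def b'_def)
  moreover have "b \<noteq> a'" using \<open>rot (rot a) \<noteq> a'\<close> by (simp add: b_def)
  moreover from this have "b' \<noteq> a" using bD(6) by (auto simp: b_def)
  ultimately have "{b, b'} \<subseteq> attach c K2" "b \<noteq> b'" using bD comps(4) a by auto
  then have b: "attach c K2 = {b, b'}" "b \<noteq> b'"
    using comps(3) card_subset_eq[of "attach c K2" "{b, b'}"] finD by (auto simp: attach_def)
  interpret S2: doubly_attached_component V D opp vert rot c K2 b b'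
    by unfold_locales (use comps(1) b loopfree in auto)
  note D2 = D2[folded S2.DK_def]
  let ?O = "strands_off c"
  have disj: "D1 \<inter> D2 = {}"
  proof -
    have "K1 \<inter> K2 = {}" using K2 by auto
    moreover have "{a, a'} \<inter> {b, b'} = {}"
      using \<open>b \<noteq> a\<close> \<open>b' \<noteq> a'\<close> \<open>b \<noteq> a'\<close> \<open>b' \<noteq> a\<close> by simp
    moreover have "vert d \<in> K1 \<or> d \<in> {a, a'}" "vert d \<in> K2 \<or> d \<in> {b, b'}" if "d \<in> D1 \<inter> D2" for d
      using that by (simp_all add: D1 D2 S1.DK_iff S2.DK_iff)
    moreover have "vert d = c" if "d \<in> {a, a'} \<or> d \<in> {b, b'}" for d
      using that aD(3,4) bD(3,4) by blast
    ultimately show ?thesis using K12 by blast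
  qed
  have D: "D = D1 \<union> D2"
  proof
    show "D \<subseteq> D1 \<union> D2"
    proof
      fix d assume d: "d \<in> D"
      then have "vert d \<in> K1 \<or> vert d \<in> K2 \<or> vert d = c" using vert K2 by auto
      moreover have "vert d = c \<Longrightarrow> d \<in> {a, a', b, b'}" using comps(4) a b d by auto
      ultimately show "d \<in> D1 \<union> D2" using d by (auto simp: D1 D2 S1.DK_iff S2.DK_iff)
    qed
  qed (use S1.DK_sub S2.DK_sub D1 D2 in auto)
  \<comment> \<open>Restoring both threads at \<open>c\<close> takes just the one pair
    \<open>(a, b)\<close>: the other thread, from \<open>a'\<close> to \<open>b'\<close>, is implied
    by the returns of the strands on the two sides.\<close>
  have "conn strands = conn (insert (a, b) ?O)"
  proof (rule conn_eqI)
    let ?I = "insert (a, b) ?O"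
    have O: "conn ?O \<subseteq> conn ?I" by (rule conn_mono) auto
    have ab: "(a, b) \<in> conn ?I" by (auto intro: conn_base)
    have "(a', a) \<in> conn ?I" "(b, b') \<in> conn ?I"
      using subsetD[OF O conn_sym[OF S1.strand_returns]] subsetD[OF O S2.strand_returns] by simp_all
    then have a'b': "(a', b') \<in> conn ?I" using ab conn_trans by metis
    show "strands \<subseteq> conn ?I"
    proof (rule subrelI)
      fix u v assume "(u, v) \<in> strands"
      then have u: "u \<in> D" "v = opp u \<or> v = rot (rot u)" by (auto simp: strands_iff)
      show "(u, v) \<in> conn ?I"
      proof (cases "(u, v) \<in> ?O")
        case True
        then show ?thesis by (auto intro: conn_base)
      next
        case False
        then have "vert u = c" "v = rot (rot u)" using u by (auto simp: strands_off_iff)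
        moreover from this have "u \<in> {a, a', b, b'}" using comps(4) a b u by auto
        ultimately have "(u, v) \<in> {(a, b), (a', b'), (b, a), (b', a')}"
          using bD by (auto simp: b_def b'_def)
        then show ?thesis using ab a'b' conn_sym[OF ab] conn_sym[OF a'b'] by auto
      qed
    qed
    have "?O \<subseteq> strands" by (auto simp: strands_off_def strands_def fgraph_def)
    moreover have "(a, b) \<in> strands" using aD by (simp add: strands_iff b_def)
    ultimately show "?I \<subseteq> conn strands" by (auto intro: conn_base)
  qed
  then have "card C = card (classes D (insert (a, b) ?O))"
    using card_threaded_circuit_partition[OF tcp] by (simp add: classes_def)
  \<comment> \<open>Severed strands do not change sides, so the pair \<open>(a, b)\<close> fuses two
    distinct classes; this accounts for the difference of one.\<close>
  moreover have "(a, b) \<notin> conn ?O"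
  proof
    assume "(a, b) \<in> conn ?O"
    moreover have "a \<in> D1" "b \<in> D2" using aD bD by (simp_all add: D1 D2 S1.DK_iff S2.DK_iff)
    ultimately have "b \<in> D1"
      using conn_closed[of a b ?O S1.DK] S1.DK_strands_off unfolding D1 by simp
    then show False using disj \<open>b \<in> D2\<close> by blast
  qed
  then have "Suc (card (classes D (insert (a, b) ?O))) = card (classes D ?O)"
    using card_classes_insert finD aD bD by metis
  moreover have "card (classes (D1 \<union> D2) ?O) = card (classes D1 ?O) + card (classes D2 ?O)"
  proof (rule card_classes_Un)
    show "finite D1" "finite D2" using finD D by (metis finite_Un)+
    show "u \<in> D1 \<longleftrightarrow> v \<in> D1" if "(u, v) \<in> ?O" for u v
      unfolding D1 using that by (rule S1.DK_strands_off)
  qed (rule disj)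
  note this[folded D]
  moreover have "card C1 = card (classes D1 ?O)"
    using S1.card_side_partition plane1 ext1 tcp1 unfolding D1 by blast
  moreover have "card C2 = card (classes D2 ?O)"
    using S2.card_side_partition plane2 ext2 tcp2 unfolding D2 by blast
  ultimately show ?thesis by simp
qed

end
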